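(* Let $n\ge1$ and let $f\in H^2(\mathbb{T}^n)$ be nonzero. There exists $g\in H^2(\mathbb{T}^n)$ with $g\perp f$ such that $f+g\in\mathcal{S}(\mathbb{D}^n)$ if and only if \[ \operatorname{dist}_{L^1(\mathbb{T}^n)}\Big(\frac{\bar f}{\|f\|_2^2},\ \mathcal{L}_n\Big)\ge 1, \] where $\mathcal{L}_n=\mathcal{M}_n\oplus H^2_0(\mathbb{T}^n)$ is regarded as a subspace of $L^1(\mathbb{T}^n)$.
   Context: $\mu$ is normalized Lebesgue measure on $\mathbb{T}^n$; $H^2(\mathbb{T}^n)$ is the closed subspace of $L^2(\mathbb{T}^n)$ of functions whose Fourier coefficients vanish off $\mathbb{Z}_+^n$ (identified with analytic functions on $\mathbb{D}^n$); $\|\cdot\|_p$ is the $L^p(\mathbb{T}^n,\mu)$ norm. $\mathcal{S}(\mathbb{D}^n)$ is the closed unit ball of $H^\infty(\mathbb{D}^n)$ with the sup norm. $H^2_0(\mathbb{T}^n)=\{h\in H^2(\mathbb{T}^n):h(0)=0\}$. $\mathcal{M}_n=L^2(\mathbb{T}^n)\ominus(\{\bar h:h\in H^2(\mathbb{T}^n)\}+H^2(\mathbb{T}^n))$, the closed span of monomials $z^k$, $k\in\mathbb{Z}^n$, with at least one positive and at least one negative exponent. $\operatorname{dist}_{L^1}(u,M)=\inf_{h\in M}\|u-h\|_1$. *)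

theory Defs
  imports "HOL-Analysis.Analysis"
begin

text \<open>The torus T^n is parametrised by t in the unit cube [0,1]^n via
  t \<mapsto> (exp(2 pi i t_j))_j; the normalized Lebesgue measure mu on T^n is the
  push-forward of Lebesgue measure on the unit cube (total mass 1).
  The dimension n is CARD('n) for a finite index type 'n.\<close>

definition torus_map :: "real^'n::finite \<Rightarrow> complex^'n" where
  "torus_map t = (\<chi> j. cis (2 * pi * t $ j))"

definition torus_measure :: "(complex^'n::finite) measure" where
  "torus_measure = distr (lebesgue_on (cbox 0 One)) borel torus_map"

definition monom_pow :: "int^'n::finite \<Rightarrow> complex^'n \<Rightarrow> complex" where
  "monom_pow k z = (\<Prod>j\<in>UNIV. (z $ j) powi (k $ j))"

definition L2 :: "(complex^'n::finite \<Rightarrow> complex) set" where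
  "L2 = {u. u \<in> borel_measurable torus_measure \<and>
            integrable torus_measure (\<lambda>z. (cmod (u z))^2)}"

definition l2_inner :: "(complex^'n::finite \<Rightarrow> complex) \<Rightarrow> (complex^'n \<Rightarrow> complex) \<Rightarrow> complex" where
  "l2_inner u v = integral\<^sup>L torus_measure (\<lambda>z. u z * cnj (v z))"

definition norm1 :: "(complex^'n::finite \<Rightarrow> complex) \<Rightarrow> real" where
  "norm1 u = integral\<^sup>L torus_measure (\<lambda>z. cmod (u z))"

definition norm2 :: "(complex^'n::finite \<Rightarrow> complex) \<Rightarrow> real" where
  "norm2 u = sqrt (integral\<^sup>L torus_measure (\<lambda>z. (cmod (u z))^2))"

definition fourier_coeff :: "(complex^'n::finite \<Rightarrow> complex) \<Rightarrow> int^'n \<Rightarrow> complex" where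
  "fourier_coeff u k = integral\<^sup>L torus_measure (\<lambda>z. u z * cnj (monom_pow k z))"

definition H2 :: "(complex^'n::finite \<Rightarrow> complex) set" where
  "H2 = {u \<in> L2. \<forall>k. (\<exists>j. k $ j < 0) \<longrightarrow> fourier_coeff u k = 0}"

definition analytic_ext :: "(complex^'n::finite \<Rightarrow> complex) \<Rightarrow> complex^'n \<Rightarrow> complex" where
  "analytic_ext u z = infsum (\<lambda>k. fourier_coeff u k * monom_pow k z) {k. \<forall>j. 0 \<le> k $ j}"

definition polydisc :: "(complex^'n::finite) set" where
  "polydisc = {z. \<forall>j. cmod (z $ j) < 1}"

text \<open>S(D^n): closed unit ball of H^infty(D^n) (as H^2 functions, via their extension).\<close>
definition schur_class :: "(complex^'n::finite \<Rightarrow> complex) set" where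
  "schur_class = {u \<in> H2. \<forall>z\<in>polydisc. cmod (analytic_ext u z) \<le> 1}"

definition H2_0 :: "(complex^'n::finite \<Rightarrow> complex) set" where
  "H2_0 = {u \<in> H2. analytic_ext u 0 = 0}"

text \<open>M_n: closed span of monomials z^k with at least one positive and one negative exponent.\<close>
definition M_space :: "(complex^'n::finite \<Rightarrow> complex) set" where
  "M_space = {u \<in> L2. \<forall>k. \<not> ((\<exists>i. 0 < k $ i) \<and> (\<exists>j. k $ j < 0)) \<longrightarrow> fourier_coeff u k = 0}"

definition L_space :: "(complex^'n::finite \<Rightarrow> complex) set" where
  "L_space = {(\<lambda>z. m z + h z) | m h. m \<in> M_space \<and> h \<in> H2_0}"

definition dist_L1 :: "(complex^'n::finite \<Rightarrow> complex) \<Rightarrow> (complex^'n \<Rightarrow> complex) set \<Rightarrow> real" where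
  "dist_L1 u M = (INF h\<in>M. norm1 (\<lambda>z. u z - h z))"

end

theory Submission
  imports Defs
begin

text \<open>If \<open>\<phi> = f + g\<close> is in the Schur class, then \<open>\<phi>\<close> annihilates \<open>\<L>\<^sub>n\<close>, pairs to \<open>1\<close> with
  \<open>cnj f / \<parallel>f\<parallel>\<^sup>2\<close>, and has sup norm at most \<open>1\<close>, so the \<open>L\<^sup>1\<close>-distance is at least \<open>1\<close>.
  Conversely, let \<open>K\<close> be the unit ball of \<open>L\<^sup>\<infinity>\<close> and \<open>B\<close> the orthogonal complement of \<open>f\<close> in \<open>H\<^sup>2\<close>.
  Let \<open>x\<close> be the element of least norm in the \<open>L\<^sup>2\<close>-closure of the convex set \<open>K + B - f\<close>.  If
  \<open>x \<noteq> 0\<close>, the variational inequality for \<open>x\<close> produces an element of \<open>\<L>\<^sub>n\<close> closer than \<open>1\<close> to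
  \<open>cnj f / \<parallel>f\<parallel>\<^sup>2\<close>.  So \<open>x = 0\<close>, and elements of least norm in the nested convex sets
  \<open>{\<phi> \<in> K. dist (f - \<phi>) B \<le> 1/j}\<close> converge to some \<open>\<phi> \<in> K\<close> with \<open>f - \<phi> \<in> B\<close>.  Working with
  convex sets in \<open>L\<^sup>2\<close> throughout avoids the Hahn-Banach theorem and the dual of \<open>L\<^sup>1\<close>.\<close>

subsection \<open>The torus and its monomials\<close>

text \<open>The Schur class is defined by values of the analytic extension inside the polydisc,
  while the distance concerns functions on the torus. Both implications must cross between the two,
  and neither uses radial limits. From the inside to the torus only the pairing bound
  \<open>cmod (l2_inner u \<phi>) \<le> norm1 u\<close> is needed, and it comes from the dilations
  \<phi>(r w) with r < 1. From the torus to the inside, squared moduli of truncated Szego kernels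
  play the role of the Poisson kernel.

  The element of \<open>L_space\<close> in the converse arises as follows. The minimal vector x is
  orthogonal to B, so among directions of H^2 it can only see f. Removing its component along f
  leaves w orthogonal to all of H^2, and orthogonality to H^2 says exactly that the conjugate of w
  has no coefficient at exponents k \<le> 0, which characterises \<open>L_space\<close>. Testing the
  ball K with -x/|x| gives \<open>norm1 x\<close> < |<f,x>|; dividing by <f,x> turns this into a
  distance below 1.\<close>

lemma continuous_torus_map: "continuous_on S (torus_map :: real^'n::finite \<Rightarrow> complex^'n)"
  unfolding torus_map_def by (intro continuous_intros)

lemma borel_measurable_torus_map [measurable]:
  "(torus_map :: real^'n::finite \<Rightarrow> complex^'n) \<in> borel_measurable borel"
  by (intro borel_measurable_continuous_onI continuous_torus_map)

lemma measurable_torus_map_lebesgue_on: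
  "(torus_map :: real^'n::finite \<Rightarrow> complex^'n) \<in> borel_measurable (lebesgue_on S)"
  using borel_measurable_torus_map
  by (metis measurable_completion measurable_lborel2 measurable_restrict_space1)

lemma sets_torus_measure [measurable_cong, simp]: "sets torus_measure = sets borel"
  by (simp add: torus_measure_def)

lemma space_torus_measure [simp]: "space torus_measure = UNIV"
  by (simp add: torus_measure_def)

lemma borel_measurable_torus_measure [simp]:
  "borel_measurable torus_measure = borel_measurable borel"
  by (rule measurable_cong_sets) auto

lemma emeasure_torus_measure_UNIV: "emeasure (torus_measure :: (complex^'n::finite) measure) UNIV = 1"
proof -
  have "emeasure (torus_measure :: (complex^'n) measure) UNIV = emeasure lborel (cbox 0 One :: (real^'n) set)"
    unfolding torus_measure_def
    by (subst emeasure_distr)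
       (simp_all add: measurable_torus_map_lebesgue_on emeasure_restrict_space emeasure_completion)
  also have "\<dots> = 1"
    by (subst emeasure_lborel_cbox) auto
  finally show ?thesis .
qed

interpretation torus: finite_measure "torus_measure :: (complex^'n::finite) measure"
  by standard (simp add: emeasure_torus_measure_UNIV)

lemma measure_torus_measure_UNIV [simp]: "measure (torus_measure :: (complex^'n::finite) measure) UNIV = 1"
  by (simp add: measure_def emeasure_torus_measure_UNIV)

definition torus :: "(complex^'n::finite) set" where
  "torus = {z. \<forall>j. cmod (z $ j) = 1}"

lemma compact_torus: "compact (torus :: (complex^'n::finite) set)"
proof -
  have "closed (torus :: (complex^'n) set)"
    unfolding torus_def by (intro closed_Collect_all closed_Collect_eq continuous_intros)
  moreover have "bounded (torus :: (complex^'n) set)"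
  proof (rule boundedI)
    fix z :: "complex^'n" assume "z \<in> torus"
    then show "norm z \<le> CARD('n)"
      using L2_set_le_sum[of UNIV "\<lambda>j. norm (z $ j)"] by (simp add: norm_vec_def torus_def)
  qed
  ultimately show ?thesis
    by (simp add: compact_eq_bounded_closed)
qed

text \<open>Functions here live on all of complex n-space, whereas the rules for monomials (modulus
  one, conjugation negates the exponent) hold only at points whose coordinates have modulus one.
  This fact lets those rules be used under every integral.\<close>

lemma AE_torus: "AE z in (torus_measure :: (complex^'n::finite) measure). z \<in> torus"
proof -
  have "closed (torus :: (complex^'n) set)"
    by (simp add: compact_torus compact_imp_closed)
  then have "{z \<in> space borel. z \<in> (torus :: (complex^'n) set)} \<in> sets borel"
    by simp
  then show ?thesis
    unfolding torus_measure_def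
    by (subst AE_distr_iff[OF measurable_torus_map_lebesgue_on])
       (auto simp: torus_def torus_map_def)
qed

text \<open>The torus measure comes from completed Lebesgue measure on the cube. Passing to
  \<open>lborel\<close> with an indicator makes the product structure, and hence Fubini,
  available.\<close>

lemma integral_torus_measure:
  fixes u :: "complex^'n::finite \<Rightarrow> complex"
  assumes [measurable]: "u \<in> borel_measurable borel"
  shows "integral\<^sup>L torus_measure u
    = integral\<^sup>L lborel (\<lambda>t. indicator (cbox 0 One) t *\<^sub>R u (torus_map t))"
proof -
  have "integral\<^sup>L torus_measure u = integral\<^sup>L (lebesgue_on (cbox 0 One)) (\<lambda>t. u (torus_map t))"
    unfolding torus_measure_def
    by (rule integral_distr) (simp_all add: measurable_torus_map_lebesgue_on)
  also have "\<dots> = integral\<^sup>L lebesgue (\<lambda>t. indicator (cbox 0 One) t *\<^sub>R u (torus_map t))"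
    by (rule integral_restrict_space) auto
  also have "\<dots> = integral\<^sup>L lborel (\<lambda>t. indicator (cbox 0 One) t *\<^sub>R u (torus_map t))"
    by (rule integral_completion) measurable
  finally show ?thesis .
qed

section \<open>Algebra of the monomials\<close>

lemma monom_pow_0 [simp]: "monom_pow 0 z = 1"
  by (simp add: monom_pow_def)

lemma monom_pow_times: "monom_pow k (z * w) = monom_pow k z * monom_pow k w"
  by (simp add: monom_pow_def power_int_mult_distrib prod.distrib)

lemma monom_pow_add:
  assumes "z \<in> torus" shows "monom_pow (k + l) z = monom_pow k z * monom_pow l z"
proof -
  have "z $ j \<noteq> 0" for j using assms by (auto simp: torus_def dest!: spec[of _ j])
  then show ?thesis
    by (simp add: monom_pow_def power_int_add prod.distrib)
qed

lemma norm_monom_pow_torus: "z \<in> torus \<Longrightarrow> cmod (monom_pow k z) = 1"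
  by (simp add: monom_pow_def torus_def norm_power_int flip: prod_norm)

lemma monom_pow_uminus:
  assumes "z \<in> torus" shows "monom_pow (- k) z = cnj (monom_pow k z)"
proof -
  have "monom_pow (- k) z * monom_pow k z = 1"
    using monom_pow_add[OF assms, of "-k" k] by simp
  moreover have "cnj (monom_pow k z) * monom_pow k z = 1"
    using norm_monom_pow_torus[OF assms, of k] by (simp add: mult.commute complex_norm_square[symmetric])
  moreover have "monom_pow k z \<noteq> 0"
    using norm_monom_pow_torus[OF assms, of k] by auto
  ultimately show ?thesis
    by (metis mult_right_cancel)
qed

lemma borel_measurable_monom_pow [measurable]:
  "(monom_pow k :: complex^'n::finite \<Rightarrow> complex) \<in> borel_measurable borel"
proof -
  have [measurable]: "(\<lambda>z :: complex^'n. z $ j) \<in> borel_measurable borel" for j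
    by (intro borel_measurable_continuous_onI continuous_intros)
  have "(\<lambda>z :: complex^'n. (z $ j) powi (k $ j)) \<in> borel_measurable borel" for j
    unfolding power_int_def by measurable
  then show ?thesis
    unfolding monom_pow_def[abs_def] by (rule borel_measurable_prod)
qed

section \<open>Orthonormality of the monomials\<close>

lemma integral_lborel_prod:
  fixes g :: "'n::finite \<Rightarrow> real \<Rightarrow> complex"
  assumes "\<And>j. integrable lborel (g j)"
  shows "integral\<^sup>L lborel (\<lambda>t :: real^'n. \<Prod>j\<in>UNIV. g j (t $ j)) = (\<Prod>j\<in>UNIV. integral\<^sup>L lborel (g j))"
proof -
  interpret product_sigma_finite "\<lambda>_ :: real^'n. lborel :: real measure" ..
  \<comment> \<open>\<open>lborel\<close> on a Euclidean space is a product measure indexed by basis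
    vectors, so the factors are re-indexed from coordinates j to the vectors
    \<open>axis j 1\<close>.\<close>
  define G where "G b = g (THE j. b = axis j 1)" for b :: "real^'n"
  have G: "G (axis j 1) = g j" for j
    unfolding G_def by (rule arg_cong[where f=g]) (auto simp: axis_eq_axis)
  have B: "(Basis :: (real^'n) set) = (\<lambda>j. axis j 1) ` UNIV"
    by (auto simp: Basis_vec_def)
  have inj: "inj (\<lambda>j::'n. axis j (1::real))"
    by (auto simp: inj_def axis_eq_axis)
  have re: "(\<Prod>b\<in>Basis. h b) = (\<Prod>j\<in>UNIV. h (axis j (1::real)))" for h :: "real^'n \<Rightarrow> complex"
    unfolding B by (subst prod.reindex[OF inj]) simp
  have int: "integrable lborel (G b)" if "b \<in> Basis" for b
    using that assms by (auto simp: B G)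
  have [measurable]: "g j \<in> borel_measurable borel" for j
    using assms[of j] by auto
  have [measurable]: "(\<lambda>z :: real^'n. z $ j) \<in> borel_measurable borel" for j
    by (intro borel_measurable_continuous_onI continuous_intros)
  have "integral\<^sup>L lborel (\<lambda>t :: real^'n. \<Prod>j\<in>UNIV. g j (t $ j))
      = integral\<^sup>L (\<Pi>\<^sub>M b\<in>Basis. lborel) (\<lambda>x. \<Prod>j\<in>UNIV. g j ((\<Sum>b\<in>Basis. x b *\<^sub>R b :: real^'n) $ j))"
    by (subst lborel_eq, subst integral_distr) auto
  also have "\<dots> = integral\<^sup>L (\<Pi>\<^sub>M b\<in>Basis. lborel) (\<lambda>x. \<Prod>b\<in>(Basis :: (real^'n) set). G b (x b))"
  proof (rule arg_cong[where f="integral\<^sup>L _"], rule ext)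
    fix x :: "real^'n \<Rightarrow> real"
    have "(\<Sum>b\<in>Basis. x b *\<^sub>R b :: real^'n) $ j = x (axis j 1)" for j
    proof -
      have "(\<Sum>b\<in>Basis. x b *\<^sub>R b :: real^'n) $ j = (\<Sum>b\<in>Basis. x b *\<^sub>R b :: real^'n) \<bullet> axis j 1"
        by (simp add: inner_axis)
      also have "\<dots> = x (axis j 1)"
        by (rule inner_sum_left_Basis) (auto simp: B)
      finally show ?thesis .
    qed
    then show "(\<Prod>j\<in>UNIV. g j ((\<Sum>b\<in>Basis. x b *\<^sub>R b :: real^'n) $ j)) = (\<Prod>b\<in>Basis. G b (x b))"
      by (simp add: re G)
  qed
  also have "\<dots> = (\<Prod>b\<in>Basis. integral\<^sup>L lborel (G b))"
    by (rule product_integral_prod) (auto intro: int)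
  also have "\<dots> = (\<Prod>j\<in>UNIV. integral\<^sup>L lborel (g j))"
    by (simp add: re G)
  finally show ?thesis .
qed

lemma integral_cis_unit_interval:
  fixes m :: int
  shows "integrable lborel (\<lambda>t::real. indicator {0..1} t *\<^sub>R cis (2 * pi * t) powi m)" (is "integrable _ ?f")
    and "integral\<^sup>L lborel (\<lambda>t::real. indicator {0..1} t *\<^sub>R cis (2 * pi * t) powi m) = (if m = 0 then 1 else 0)"
proof -
  have c: "continuous_on {0..1} (\<lambda>t. cis (2 * pi * t) powi m)"
    by (intro continuous_intros) auto
  then show int: "integrable lborel ?f"
    using borel_integrable_atLeastAtMost'[of 0 1 "\<lambda>t. cis (2 * pi * t) powi m"]
    by (simp add: set_integrable_def)
  show "integral\<^sup>L lborel ?f = (if m = 0 then 1 else 0)"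
  proof (cases "m = 0")
    case True then show ?thesis by (simp)
  next
    case False
    define F where "F t = cis (2 * pi * t * m) / (\<i> * (2 * pi * m))" for t
    have "integral\<^sup>L lborel ?f = F 1 - F 0"
    proof (rule integral_FTC_Icc)
      show "(F has_vector_derivative cis (2 * pi * t) powi m) (at t within {0..1})" for t
      proof -
        have "((\<lambda>z. exp (\<i> * (2 * pi * z * m)) / (\<i> * (2 * pi * m))) has_field_derivative
            exp (\<i> * (2 * pi * t * m))) (at (complex_of_real t))"
          using False by (auto intro!: derivative_eq_intros simp: field_simps)
        from has_vector_derivative_real_field[OF this] show ?thesis
          by (simp add: F_def[abs_def] cis_conv_exp exp_power_int mult_ac)
      qed
    qed (use c in auto)
    also have "F 1 = F 0"
      using cis_multiple_2pi[of "of_int m"] by (simp add: F_def)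
    finally show ?thesis using False by simp
  qed
qed

lemma integral_monom_pow:
  "integral\<^sup>L torus_measure (monom_pow k :: complex^'n::finite \<Rightarrow> complex) = (if k = 0 then 1 else 0)"
proof -
  define g where "g j t = indicator {0..1} t *\<^sub>R cis (2 * pi * t) powi (k $ j)" for j and t :: real
  have One: "(One :: real^'n) $ j = 1" for j
    using inner_sum_left_Basis[of "axis j 1 :: real^'n" "\<lambda>_. 1"]
    by (simp add: inner_axis axis_in_Basis_iff)
  have "indicator (cbox 0 One) t *\<^sub>R monom_pow k (torus_map t) = (\<Prod>j\<in>UNIV. g j (t $ j))" for t :: "real^'n"
  proof (cases "t \<in> cbox 0 One")
    case True
    then have "t $ j \<in> {0..1}" for j by (auto simp: mem_box_cart One simp del: sum_component)
    with True show ?thesis by (simp add: g_def monom_pow_def torus_map_def)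
  next
    case False
    then obtain j where "t $ j \<notin> {0..1}" by (auto simp: mem_box_cart One simp del: sum_component)
    then have "g j (t $ j) = 0" by (simp add: g_def indicator_def)
    then have "(\<Prod>j\<in>UNIV. g j (t $ j)) = 0" by auto
    with False show ?thesis by simp
  qed
  then have "integral\<^sup>L torus_measure (monom_pow k :: complex^'n \<Rightarrow> complex)
     = (\<Prod>j\<in>UNIV. integral\<^sup>L lborel (g j))"
    using integral_lborel_prod[of g] integral_cis_unit_interval(1)
    by (simp add: integral_torus_measure g_def[abs_def])
  also have "\<dots> = (if k = 0 then 1 else 0)"
    by (auto simp: g_def[abs_def] integral_cis_unit_interval vec_eq_iff)
  finally show ?thesis .
qed

subsection \<open>The space \<open>L\<^sup>2\<close>\<close>

lemma L2_measurable [measurable_dest]: "u \<in> L2 \<Longrightarrow> u \<in> borel_measurable borel"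
  by (simp add: L2_def)

lemma L2_integrable_square: "u \<in> L2 \<Longrightarrow> integrable torus_measure (\<lambda>z. (cmod (u z))^2)"
  by (simp add: L2_def)

lemma L2_integrable_norm_mult:
  assumes "u \<in> L2" "v \<in> L2"
  shows "integrable torus_measure (\<lambda>z. cmod (u z) * cmod (v z))"
proof (rule Bochner_Integration.integrable_bound)
  show "integrable torus_measure (\<lambda>z. (cmod (u z))^2 + (cmod (v z))^2)"
    using assms by (intro Bochner_Integration.integrable_add L2_integrable_square)
  show "(\<lambda>z. cmod (u z) * cmod (v z)) \<in> borel_measurable torus_measure"
    using assms[THEN L2_measurable] by simp
  have "a * b \<le> a^2 + b^2" if "a \<ge> 0" "b \<ge> 0" for a b :: real
    using sum_squares_bound[of a b] mult_nonneg_nonneg[OF that] by linarith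
  then show "AE z in torus_measure. norm (cmod (u z) * cmod (v z)) \<le> norm ((cmod (u z))^2 + (cmod (v z))^2)"
    by simp
qed

lemma L2_integrable_mult:
  assumes "u \<in> L2" "v \<in> L2" shows "integrable torus_measure (\<lambda>z. u z * v z)"
  by (rule Bochner_Integration.integrable_bound[OF L2_integrable_norm_mult[OF assms]])
     (use assms[THEN L2_measurable] in \<open>auto simp: norm_mult\<close>)

lemma borel_measurable_cnj [measurable]: "cnj \<in> borel_measurable borel"
  by (intro borel_measurable_continuous_onI continuous_intros)

lemma L2_cnj: "u \<in> L2 \<Longrightarrow> (\<lambda>z. cnj (u z)) \<in> L2"
  by (auto simp: L2_def intro: measurable_compose[OF _ borel_measurable_cnj])

lemma L2_integrable_inner:
  assumes "u \<in> L2" "v \<in> L2" shows "integrable torus_measure (\<lambda>z. u z * cnj (v z))"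
  by (rule L2_integrable_mult[OF assms(1) L2_cnj[OF assms(2)]])

lemma L2_mult_bounded:
  assumes "u \<in> L2" "v \<in> borel_measurable borel" "AE z in torus_measure. cmod (v z) \<le> B"
  shows "(\<lambda>z. v z * u z) \<in> L2"
proof -
  have "integrable torus_measure (\<lambda>z. (cmod (v z * u z))^2)"
  proof (rule Bochner_Integration.integrable_bound)
    show "integrable torus_measure (\<lambda>z. B^2 * (cmod (u z))^2)"
      using assms(1) by (intro integrable_mult_right L2_integrable_square)
    show "AE z in torus_measure. norm ((cmod (v z * u z))^2) \<le> norm (B^2 * (cmod (u z))^2)"
      using assms(3) by eventually_elim
        (auto simp: norm_mult power_mult_distrib intro!: mult_right_mono power_mono)
  qed (use assms L2_measurable in auto)
  then show ?thesis
    using assms(2) L2_measurable[OF assms(1)] by (auto simp: L2_def)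
qed

lemma L2_const: "(\<lambda>z. c) \<in> L2"
  by (simp add: L2_def)

lemma L2_bounded:
  assumes "v \<in> borel_measurable borel" "AE z in torus_measure. cmod (v z) \<le> B"
  shows "v \<in> L2"
  using L2_mult_bounded[OF L2_const[of 1] assms] by simp

lemma L2_cmult: "u \<in> L2 \<Longrightarrow> (\<lambda>z. c * u z) \<in> L2"
  by (rule L2_mult_bounded[where B="cmod c"]) auto

lemma L2_add:
  assumes "u \<in> L2" "v \<in> L2" shows "(\<lambda>z. u z + v z) \<in> L2"
proof -
  have "integrable torus_measure (\<lambda>z. (cmod (u z + v z))^2)"
  proof (rule Bochner_Integration.integrable_bound)
    show "integrable torus_measure (\<lambda>z. 2 * (cmod (u z))^2 + 2 * (cmod (v z))^2)"
      using assms by (intro Bochner_Integration.integrable_add integrable_mult_right L2_integrable_square)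
    have "(cmod (a + b))^2 \<le> 2 * (cmod a)^2 + 2 * (cmod b)^2" for a b
      using zero_le_power2[of "cmod (a - b)"]
      by (simp add: power2_norm_eq_inner inner_add_left inner_add_right inner_diff_left inner_diff_right inner_commute)
    then show "AE z in torus_measure. norm ((cmod (u z + v z))^2) \<le> norm (2 * (cmod (u z))^2 + 2 * (cmod (v z))^2)"
      by simp
  qed (use assms[THEN L2_measurable] in auto)
  then show ?thesis
    using assms[THEN L2_measurable] by (simp add: L2_def)
qed

lemma L2_diff: "u \<in> L2 \<Longrightarrow> v \<in> L2 \<Longrightarrow> (\<lambda>z. u z - v z) \<in> L2"
  using L2_add[of u "\<lambda>z. (-1) * v z"] L2_cmult[of v "-1"] by simp

lemma L2_sum: "(\<And>i. i \<in> I \<Longrightarrow> u i \<in> L2) \<Longrightarrow> (\<lambda>z. \<Sum>i\<in>I. u i z) \<in> L2"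
  by (induction I rule: infinite_finite_induct) (auto intro: L2_add L2_const)

lemma L2_integrable: "u \<in> L2 \<Longrightarrow> integrable torus_measure u"
  using L2_integrable_mult[OF _ L2_const[of 1], of u] by simp

lemma L2_monom_pow: "monom_pow k \<in> L2"
proof (rule L2_bounded)
  show "AE z in torus_measure. cmod (monom_pow k z) \<le> 1"
    using AE_torus by eventually_elim (simp add: norm_monom_pow_torus)
qed measurable

section \<open>Norm, inner product and the Cauchy-Schwarz inequality\<close>

lemma norm2_nonneg [simp]: "norm2 u \<ge> 0"
  by (simp add: norm2_def)

lemma norm2_square: "(norm2 u)^2 = integral\<^sup>L torus_measure (\<lambda>z. (cmod (u z))^2)"
  by (simp add: norm2_def)

lemma l2_inner_self: "l2_inner u u = of_real ((norm2 u)^2)"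
  unfolding l2_inner_def norm2_square
  by (simp only: complex_norm_square[symmetric] integral_complex_of_real flip: of_real_power)

lemma norm2_cmult: "norm2 (\<lambda>z. c * u z) = cmod c * norm2 u"
  by (simp add: norm2_def norm_mult power_mult_distrib real_sqrt_mult)

lemma norm2_minus_commute: "norm2 (\<lambda>z. u z - v z) = norm2 (\<lambda>z. v z - u z)"
  by (simp add: norm2_def norm_minus_commute)

lemma norm2_eq_0_iff:
  assumes "u \<in> L2" shows "norm2 u = 0 \<longleftrightarrow> (AE z in torus_measure. u z = 0)"
  using integral_nonneg_eq_0_iff_AE[OF L2_integrable_square[OF assms]] by (simp add: norm2_def)

lemma norm2_cong_AE:
  assumes "u \<in> L2" "v \<in> L2" "AE z in torus_measure. u z = v z" shows "norm2 u = norm2 v"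
  unfolding norm2_def
  using assms(1,2)[THEN L2_measurable] assms(3) by (auto intro!: integral_cong_AE)

lemma norm2_add_square:
  assumes "u \<in> L2" "v \<in> L2"
  shows "(norm2 (\<lambda>z. u z + v z))^2 = (norm2 u)^2 + 2 * Re (l2_inner u v) + (norm2 v)^2"
proof -
  have e: "(cmod (a + b))^2 = (cmod a)^2 + 2 * Re (a * cnj b) + (cmod b)^2" for a b
    unfolding cmod_power2 by (simp add: power2_eq_square algebra_simps)
  have "integrable torus_measure (\<lambda>z. Re (u z * cnj (v z)))"
    using L2_integrable_inner[OF assms] by (rule integrable_Re)
  then have "(norm2 (\<lambda>z. u z + v z))^2 = (norm2 u)^2
      + 2 * integral\<^sup>L torus_measure (\<lambda>z. Re (u z * cnj (v z))) + (norm2 v)^2"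
    unfolding norm2_square e using assms[THEN L2_integrable_square]
    by (simp del: complex_cnj times_complex.sel)
  then show ?thesis
    using L2_integrable_inner[OF assms] by (simp add: l2_inner_def del: times_complex.sel)
qed

lemma Cauchy_Schwarz_norm2:
  assumes "u \<in> L2" "v \<in> L2"
  shows "integral\<^sup>L torus_measure (\<lambda>z. cmod (u z) * cmod (v z)) \<le> norm2 u * norm2 v"
proof -
  define X where "X = integral\<^sup>L torus_measure (\<lambda>z. cmod (u z) * cmod (v z))"
  note int = assms[THEN L2_integrable_square] L2_integrable_norm_mult[OF assms]
  have X: "X \<ge> 0" unfolding X_def by simp
  have quad: "0 \<le> s^2 * (norm2 u)^2 - 2 * s * X + (norm2 v)^2" for s
  proof -
    have "0 \<le> integral\<^sup>L torus_measure (\<lambda>z. (s * cmod (u z) - cmod (v z))^2)"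
      by simp
    also have "\<dots> = integral\<^sup>L torus_measure
        (\<lambda>z. s^2 * (cmod (u z))^2 - 2 * s * (cmod (u z) * cmod (v z)) + (cmod (v z))^2)"
      by (simp add: power2_eq_square algebra_simps)
    also have "\<dots> = s^2 * (norm2 u)^2 - 2 * s * X + (norm2 v)^2"
      unfolding norm2_square X_def using int by (simp del: mult_minus_left mult.assoc)
    finally show ?thesis .
  qed
  have "X^2 \<le> (norm2 u * norm2 v)^2"
  proof (cases "norm2 u = 0")
    case True
    show ?thesis
    proof (rule ccontr)
      assume "\<not> ?thesis"
      then have "X > 0" using X True by (simp add: power2_eq_square zero_less_mult_iff not_le)
      \<comment> \<open>With \<open>norm2 u = 0\<close> the quadratic is affine in s; this s makes
        its value -1.\<close>
      then show False using quad[of "((norm2 v)^2 + 1) / (2 * X)"] True by simp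
    qed
  next
    case False
    then have p: "(norm2 u)^2 > 0" by simp
    \<comment> \<open>The quadratic is evaluated at its vertex s = X /
      \<open>(norm2 u)^2\<close>.\<close>
    have "0 \<le> (norm2 u)^2 * ((X / (norm2 u)^2)^2 * (norm2 u)^2 - 2 * (X / (norm2 u)^2) * X + (norm2 v)^2)"
      using quad[of "X / (norm2 u)^2"] by (intro mult_nonneg_nonneg) auto
    also have "\<dots> = (norm2 u)^2 * (norm2 v)^2 - X^2"
      using p False by (simp add: field_simps power2_eq_square)
    finally show ?thesis by (simp add: power_mult_distrib)
  qed
  then show ?thesis
    unfolding X_def[symmetric] by (rule power2_le_imp_le) simp
qed

lemma norm_l2_inner_le:
  assumes "u \<in> L2" "v \<in> L2" shows "cmod (l2_inner u v) \<le> norm2 u * norm2 v"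
proof -
  have "cmod (l2_inner u v) \<le> integral\<^sup>L torus_measure (\<lambda>z. cmod (u z * cnj (v z)))"
    unfolding l2_inner_def by (rule integral_norm_bound)
  also have "\<dots> \<le> norm2 u * norm2 v"
    using Cauchy_Schwarz_norm2[OF assms] by (simp add: norm_mult)
  finally show ?thesis .
qed

lemma norm1_le_norm2: "u \<in> L2 \<Longrightarrow> norm1 u \<le> norm2 u"
  using Cauchy_Schwarz_norm2[OF _ L2_const[of 1], of u] by (simp add: norm1_def norm2_def)

lemma norm2_triangle:
  assumes "u \<in> L2" "v \<in> L2" shows "norm2 (\<lambda>z. u z + v z) \<le> norm2 u + norm2 v"
proof (rule power2_le_imp_le)
  have "Re (l2_inner u v) \<le> norm2 u * norm2 v"
    using norm_l2_inner_le[OF assms] complex_Re_le_cmod order_trans by blast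
  then show "(norm2 (\<lambda>z. u z + v z))^2 \<le> (norm2 u + norm2 v)^2"
    by (simp add: norm2_add_square[OF assms] power2_sum)
qed simp

lemma l2_inner_add_left:
  "u \<in> L2 \<Longrightarrow> v \<in> L2 \<Longrightarrow> w \<in> L2 \<Longrightarrow> l2_inner (\<lambda>z. u z + v z) w = l2_inner u w + l2_inner v w"
  by (simp add: l2_inner_def distrib_right L2_integrable_inner)

lemma l2_inner_diff_left:
  "u \<in> L2 \<Longrightarrow> v \<in> L2 \<Longrightarrow> w \<in> L2 \<Longrightarrow> l2_inner (\<lambda>z. u z - v z) w = l2_inner u w - l2_inner v w"
  by (simp add: l2_inner_def left_diff_distrib L2_integrable_inner)

lemma l2_inner_cmult_left: "l2_inner (\<lambda>z. c * u z) v = c * l2_inner u v"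
  by (simp add: l2_inner_def mult.assoc)

lemma l2_inner_commute: "l2_inner u v = cnj (l2_inner v u)"
  unfolding l2_inner_def by (subst Bochner_Integration.integral_cnj[symmetric]) (simp add: mult.commute)

lemma fourier_coeff_eq_inner: "fourier_coeff u k = l2_inner u (monom_pow k)"
  by (simp add: fourier_coeff_def l2_inner_def)

text \<open>\<open>norm2\<close> is only a seminorm on the functions in \<open>L2\<close>, so limits
  in this sense are determined only almost everywhere.\<close>

definition l2_conv :: "(nat \<Rightarrow> complex^'n::finite \<Rightarrow> complex) \<Rightarrow> (complex^'n \<Rightarrow> complex) \<Rightarrow> bool" where
  "l2_conv X x \<longleftrightarrow> (\<lambda>j. norm2 (\<lambda>z. X j z - x z)) \<longlonglongrightarrow> 0"

lemma l2_conv_inner: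
  assumes "l2_conv X x" "\<And>j. X j \<in> L2" "x \<in> L2" "v \<in> L2"
  shows "(\<lambda>j. l2_inner (X j) v) \<longlonglongrightarrow> l2_inner x v"
proof (rule LIM_zero_cancel, rule Lim_null_comparison)
  show "\<forall>\<^sub>F j in sequentially. norm (l2_inner (X j) v - l2_inner x v) \<le> norm2 (\<lambda>z. X j z - x z) * norm2 v"
    using norm_l2_inner_le[OF L2_diff[OF assms(2,3)] assms(4)] assms
    by (simp add: l2_inner_diff_left)
  show "(\<lambda>j. norm2 (\<lambda>z. X j z - x z) * norm2 v) \<longlonglongrightarrow> 0"
    using assms(1) by (auto simp: l2_conv_def intro: tendsto_mult_left_zero)
qed

lemma l2_conv_norm2:
  assumes "l2_conv X x" "\<And>j. X j \<in> L2" "x \<in> L2"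
  shows "(\<lambda>j. norm2 (X j)) \<longlonglongrightarrow> norm2 x"
proof (rule LIM_zero_cancel, rule Lim_null_comparison)
  have "\<bar>norm2 (X j) - norm2 x\<bar> \<le> norm2 (\<lambda>z. X j z - x z)" for j
    using norm2_triangle[OF L2_diff[OF assms(2,3)] assms(3), of j]
      norm2_triangle[OF L2_diff[OF assms(3,2)] assms(2), of j j]
    by (simp add: norm2_minus_commute[of x] abs_le_iff)
  then show "\<forall>\<^sub>F j in sequentially. norm (norm2 (X j) - norm2 x) \<le> norm2 (\<lambda>z. X j z - x z)"
    by simp
  show "(\<lambda>j. norm2 (\<lambda>z. X j z - x z)) \<longlonglongrightarrow> 0"
    using assms(1) by (simp add: l2_conv_def)
qed

subsection \<open>Completeness and convex sets\<close>

text \<open>The Riesz-Fischer argument: a subsequence with geometrically small steps converges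
  absolutely almost everywhere, because the total of its steps has finite integral. Fatou's lemma
  then transfers the Cauchy estimate to the pointwise limit.\<close>

lemma L2_complete:
  fixes X :: "nat \<Rightarrow> complex^'n::finite \<Rightarrow> complex"
  assumes X: "\<And>i. X i \<in> L2"
    and Cauchy: "\<And>e. e > 0 \<Longrightarrow> \<exists>N. \<forall>i\<ge>N. \<forall>j\<ge>N. norm2 (\<lambda>z. X i z - X j z) < e"
  obtains x where "x \<in> L2" "l2_conv X x"
proof -
  have [measurable]: "X i \<in> borel_measurable borel" for i
    using X[of i] by (rule L2_measurable)
  have "\<exists>N. \<forall>i\<ge>N. \<forall>j\<ge>N. norm2 (\<lambda>z. X i z - X j z) < (1/2)^n" for n :: nat
    by (rule Cauchy) simp
  then obtain N where N: "\<And>n i j. i \<ge> N n \<Longrightarrow> j \<ge> N n \<Longrightarrow> norm2 (\<lambda>z. X i z - X j z) < (1/2)^n"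
    by metis
  \<comment> \<open>The thresholds N need not increase in n; their partial sums dominate all earlier
    ones, so the single index r m serves every n \<le> m.\<close>
  define r where "r n = (\<Sum>k\<le>n. N k)" for n
  have r_ge: "r m \<ge> N n" if "n \<le> m" for m n
    unfolding r_def using that by (intro member_le_sum) auto
  define D where "D n z = X (r (Suc n)) z - X (r n) z" for n z
  have [measurable]: "D n \<in> borel_measurable borel" for n
    unfolding D_def[abs_def] by measurable
  have DL2: "D n \<in> L2" for n
    unfolding D_def[abs_def] by (intro L2_diff X)
  have D: "(\<integral>\<^sup>+z. ennreal (cmod (D n z)) \<partial>torus_measure) \<le> ennreal ((1/2)^n)" for n
  proof -
    have "(\<integral>\<^sup>+z. ennreal (cmod (D n z)) \<partial>torus_measure) = ennreal (norm1 (D n))"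
      unfolding norm1_def using L2_integrable[OF DL2]
      by (intro nn_integral_eq_integral) auto
    also have "norm1 (D n) \<le> (1/2)^n"
      using norm1_le_norm2[OF DL2, of n] N[of n "r (Suc n)" "r n"] r_ge[of n n] r_ge[of n "Suc n"]
      unfolding D_def[abs_def] by simp
    finally show ?thesis by (simp add: ennreal_leI)
  qed
  have "(\<integral>\<^sup>+z. (\<Sum>n. ennreal (cmod (D n z))) \<partial>torus_measure) = (\<Sum>n. \<integral>\<^sup>+z. ennreal (cmod (D n z)) \<partial>torus_measure)"
    by (rule nn_integral_suminf) measurable
  also have "\<dots> \<le> (\<Sum>n. ennreal ((1/2)^n))"
    by (intro suminf_le D) auto
  also have "\<dots> = ennreal 2"
    by (subst suminf_ennreal_eq[OF _ geometric_sums]) auto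
  finally have "(\<integral>\<^sup>+z. (\<Sum>n. ennreal (cmod (D n z))) \<partial>torus_measure) \<noteq> \<infinity>"
    by (auto simp: top_unique)
  then have "AE z in torus_measure. (\<Sum>n. ennreal (cmod (D n z))) \<noteq> \<infinity>"
    by (intro nn_integral_PInf_AE) measurable
  then have conv: "AE z in torus_measure. convergent (\<lambda>n. X (r n) z)"
  proof eventually_elim
    case (elim z)
    then have "summable (\<lambda>n. cmod (D n z))"
      by (intro summable_suminf_not_top) auto
    then have "summable (\<lambda>n. D n z)"
      by (rule summable_norm_cancel)
    then have "convergent (\<lambda>m. \<Sum>n<m. D n z)"
      by (simp add: summable_iff_convergent)
    then have "convergent (\<lambda>m. X (r m) z - X (r 0) z)"
      unfolding D_def by (subst (asm) sum_lessThan_telescope)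
    from convergent_add[OF this convergent_const[of "X (r 0) z"]] show ?case
      by simp
  qed
  \<comment> \<open>Where the subsequence diverges, \<open>lim\<close> takes an unspecified value;
    this happens only on a null set.\<close>
  define x where "x z = lim (\<lambda>n. X (r n) z)" for z
  have [measurable]: "x \<in> borel_measurable borel"
    unfolding x_def[abs_def] by measurable
  have lim: "AE z in torus_measure. (\<lambda>n. X (r n) z) \<longlonglongrightarrow> x z"
    using conv by eventually_elim (simp add: x_def convergent_LIMSEQ_iff)
  \<comment> \<open>The index i ranges over the whole sequence and only the other index runs through
    the subsequence, so the estimate yields convergence of X itself.\<close>
  have fatou: "(\<integral>\<^sup>+z. ennreal ((cmod (x z - X i z))^2) \<partial>torus_measure) \<le> ennreal (((1/2)^n)^2)"
    if "i \<ge> N n" for i n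
  proof -
    have "(\<integral>\<^sup>+z. ennreal ((cmod (x z - X i z))^2) \<partial>torus_measure)
        = (\<integral>\<^sup>+z. liminf (\<lambda>m. ennreal ((cmod (X (r m) z - X i z))^2)) \<partial>torus_measure)"
    proof (rule nn_integral_cong_AE)
      show "AE z in torus_measure. ennreal ((cmod (x z - X i z))^2)
          = liminf (\<lambda>m. ennreal ((cmod (X (r m) z - X i z))^2))"
        using lim
      proof eventually_elim
        case (elim z)
        have "(\<lambda>m. ennreal ((cmod (X (r m) z - X i z))^2)) \<longlonglongrightarrow> ennreal ((cmod (x z - X i z))^2)"
          by (intro tendsto_intros elim)
        then show ?case by (intro lim_imp_Liminf[symmetric]) auto
      qed
    qed
    also have "\<dots> \<le> liminf (\<lambda>m. \<integral>\<^sup>+z. ennreal ((cmod (X (r m) z - X i z))^2) \<partial>torus_measure)"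
      by (rule nn_integral_liminf) measurable
    also have "\<dots> \<le> liminf (\<lambda>m. ennreal (((1/2)^n)^2))"
    proof (rule Liminf_mono, rule eventually_sequentiallyI[of n])
      fix m assume "n \<le> m"
      have L: "(\<lambda>z. X (r m) z - X i z) \<in> L2" by (intro L2_diff X)
      have "(\<integral>\<^sup>+z. ennreal ((cmod (X (r m) z - X i z))^2) \<partial>torus_measure) = ennreal ((norm2 (\<lambda>z. X (r m) z - X i z))^2)"
        unfolding norm2_square using L2_integrable_square[OF L]
        by (intro nn_integral_eq_integral) auto
      also have "\<dots> \<le> ennreal (((1/2)^n)^2)"
        using N[of n "r m" i] r_ge[OF \<open>n \<le> m\<close>] that
        by (intro ennreal_leI power_mono) auto
      finally show "(\<integral>\<^sup>+z. ennreal ((cmod (X (r m) z - X i z))^2) \<partial>torus_measure) \<le> ennreal (((1/2)^n)^2)" .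
    qed
    also have "\<dots> = ennreal (((1/2)^n)^2)"
      by (simp add: Liminf_const)
    finally show ?thesis .
  qed
  have diff: "(\<lambda>z. x z - X i z) \<in> L2" if "i \<ge> N 0" for i
  proof -
    have "integrable torus_measure (\<lambda>z. (cmod (x z - X i z))^2)"
      using fatou[OF that] by (intro integrableI_bounded) (auto intro: le_less_trans)
    then show ?thesis by (simp add: L2_def)
  qed
  have xL2: "x \<in> L2"
    using L2_add[OF diff[OF order_refl] X[of "N 0"]] by simp
  have bound: "norm2 (\<lambda>z. X i z - x z) \<le> (1/2)^n" if "i \<ge> N n" for i n
  proof -
    have L: "(\<lambda>z. x z - X i z) \<in> L2" by (intro L2_diff X xL2)
    have "ennreal ((norm2 (\<lambda>z. x z - X i z))^2) = (\<integral>\<^sup>+z. ennreal ((cmod (x z - X i z))^2) \<partial>torus_measure)"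
      unfolding norm2_square using L2_integrable_square[OF L]
      by (intro nn_integral_eq_integral[symmetric]) auto
    also note fatou[OF that]
    finally have "(norm2 (\<lambda>z. x z - X i z))^2 \<le> ((1/2)^n)^2"
      by simp
    then have "norm2 (\<lambda>z. x z - X i z) \<le> (1/2)^n"
      by (rule power2_le_imp_le) simp
    then show ?thesis by (subst norm2_minus_commute)
  qed
  have "l2_conv X x"
    unfolding l2_conv_def
  proof (rule LIMSEQ_I)
    fix e :: real assume "e > 0"
    then obtain n where "(1/2)^n < e"
      using real_arch_pow_inv[of e "1/2"] by auto
    then show "\<exists>no. \<forall>i\<ge>no. norm (norm2 (\<lambda>z. X i z - x z) - 0) < e"
      using bound[of n] by (intro exI[of _ "N n"]) (auto intro: le_less_trans)
  qed
  with xL2 show ?thesis by (rule that)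
qed

text \<open>The excess of |x| over 1 is at most |X j - x| almost everywhere, so its integral is
  bounded by a null sequence. No subsequence converging almost everywhere has to be chosen.\<close>

lemma l2_conv_norm_le_1:
  assumes "l2_conv X x" "\<And>j. X j \<in> L2" "x \<in> L2"
    and "\<And>j. AE z in torus_measure. cmod (X j z) \<le> 1"
  shows "AE z in torus_measure. cmod (x z) \<le> 1"
proof -
  let ?h = "\<lambda>z. max 0 (cmod (x z) - 1)"
  have [measurable]: "x \<in> borel_measurable borel"
    using assms(3) by (rule L2_measurable)
  have int: "integrable torus_measure ?h"
    by (rule Bochner_Integration.integrable_bound[OF L2_integrable[OF assms(3)]]) auto
  have "integral\<^sup>L torus_measure ?h \<le> norm2 (\<lambda>z. X j z - x z)" for j
  proof -
    have "integral\<^sup>L torus_measure ?h \<le> norm1 (\<lambda>z. X j z - x z)"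
      unfolding norm1_def
    proof (rule integral_mono_AE[OF int integrable_norm[OF L2_integrable[OF L2_diff[OF assms(2,3)]]]])
      show "AE z in torus_measure. ?h z \<le> cmod (X j z - x z)"
        using assms(4)[of j]
      proof eventually_elim
        case (elim z)
        then show ?case using norm_triangle_ineq2[of "x z" "X j z"] by (simp add: norm_minus_commute)
      qed
    qed
    also have "\<dots> \<le> norm2 (\<lambda>z. X j z - x z)"
      by (intro norm1_le_norm2 L2_diff assms)
    finally show ?thesis .
  qed
  then have "integral\<^sup>L torus_measure ?h \<le> 0"
    using assms(1) unfolding l2_conv_def by (intro LIMSEQ_le_const) auto
  moreover have "0 \<le> integral\<^sup>L torus_measure ?h"
    by simp
  ultimately have "integral\<^sup>L torus_measure ?h = 0"
    by simp
  then have "AE z in torus_measure. ?h z = 0"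
    using integral_nonneg_eq_0_iff_AE[OF int] by simp
  then show ?thesis by eventually_elim (simp add: max_def split: if_splits)
qed

section \<open>Elements of least norm in convex sets\<close>

lemma norm2_parallelogram:
  assumes "u \<in> L2" "v \<in> L2"
  shows "(norm2 (\<lambda>z. u z - v z))^2 = 2 * (norm2 u)^2 + 2 * (norm2 v)^2 - 4 * (norm2 (\<lambda>z. (u z + v z) / 2))^2"
proof -
  have "(norm2 (\<lambda>z. u z + (-1) * v z))^2 = (norm2 u)^2 - 2 * Re (l2_inner u v) + (norm2 v)^2"
    unfolding norm2_add_square[OF assms(1) L2_cmult[OF assms(2)]] norm2_cmult
    by (subst l2_inner_commute, subst l2_inner_cmult_left, subst l2_inner_commute) simp
  moreover have "norm2 (\<lambda>z. u z + v z) = 2 * norm2 (\<lambda>z. (u z + v z) / 2)"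
    using norm2_cmult[of "1/2" "\<lambda>z. u z + v z"] by simp
  then have "4 * (norm2 (\<lambda>z. (u z + v z) / 2))^2 = (norm2 u)^2 + 2 * Re (l2_inner u v) + (norm2 v)^2"
    by (simp add: power_mult_distrib flip: norm2_add_square[OF assms])
  ultimately show ?thesis
    by simp
qed

text \<open>This replaces weak compactness: almost minimal elements of a decreasing sequence of convex
  sets form a Cauchy sequence by the parallelogram law.\<close>

lemma nested_convex_l2_conv:
  fixes C :: "nat \<Rightarrow> (complex^'n::finite \<Rightarrow> complex) set"
  assumes L2: "\<And>j. C j \<subseteq> L2" and dec: "\<And>i j. i \<le> j \<Longrightarrow> C j \<subseteq> C i"
    and mid: "\<And>j u v. u \<in> C j \<Longrightarrow> v \<in> C j \<Longrightarrow> (\<lambda>z. (u z + v z) / 2) \<in> C j"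
    and bd: "\<And>j. \<exists>u\<in>C j. norm2 u \<le> R"
  obtains X x where "\<And>j. X j \<in> C j" "x \<in> L2" "l2_conv X x"
    "\<And>y. (\<And>j. y \<in> C j) \<Longrightarrow> norm2 x \<le> norm2 y"
proof -
  define m where "m j = (INF u\<in>C j. (norm2 u)^2)" for j
  have bb: "bdd_below ((\<lambda>u. (norm2 u)^2) ` C j)" for j
    by (rule bdd_belowI[of _ 0]) auto
  have ne: "C j \<noteq> {}" for j using bd[of j] by auto
  have m_le: "m j \<le> (norm2 u)^2" if "u \<in> C j" for u j
    unfolding m_def using bb that by (rule cINF_lower)
  have "incseq m"
    unfolding m_def by (intro monoI cINF_superset_mono ne bb dec) auto
  moreover have mR: "m j \<le> R^2" for j
  proof -
    obtain u where "u \<in> C j" "norm2 u \<le> R" using bd by blast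
    then show ?thesis using m_le[of u j] power_mono[of "norm2 u" R 2] by simp
  qed
  ultimately obtain L where L: "m \<longlonglongrightarrow> L" "\<And>j. m j \<le> L"
    using incseq_convergent[of m "R^2"] by auto
  have "\<exists>u\<in>C j. (norm2 u)^2 < m j + 1 / Suc j" for j
    using cInf_lessD[of "(\<lambda>u. (norm2 u)^2) ` C j" "m j + 1 / Suc j"] ne unfolding m_def by auto
  then obtain X where X: "\<And>j. X j \<in> C j" "\<And>j. (norm2 (X j))^2 < m j + 1 / Suc j"
    by metis
  have XL2: "X j \<in> L2" for j using X(1) L2 by blast
  \<comment> \<open>For j \<le> i both X i and X j lie in C j, and so does their midpoint, whose
    squared norm is at least m j. The parallelogram law bounds the squared distance by 2 (m i - m j)
    + 2/(i+1) + 2/(j+1), which is at most s j because m i \<le> L.\<close>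
  define s where "s j = 2 * (L - m j) + 4 * (1 / Suc j)" for j
  have "s \<longlonglongrightarrow> 2 * (L - L) + 4 * 0"
    unfolding s_def by (intro tendsto_intros L LIMSEQ_Suc[OF lim_1_over_n])
  then have s: "s \<longlonglongrightarrow> 0" by simp
  have est: "(norm2 (\<lambda>z. X i z - X j z))^2 \<le> s j" if "j \<le> i" for i j
  proof -
    have "X i \<in> C j" using dec[OF that] X(1) by blast
    then have "m j \<le> (norm2 (\<lambda>z. (X i z + X j z) / 2))^2"
      by (intro m_le mid X(1))
    moreover have "1 / Suc i \<le> 1 / Suc j" using that by (simp add: frac_le)
    moreover have "2 * p + 2 * q - 4 * M \<le> 2 * (L - b) + 4 * d"
      if "b \<le> M" "c \<le> d" "p < a + c" "q < b + d" "a \<le> L" for M a b c d p q :: real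
      using that by simp
    ultimately show ?thesis
      using X(2)[of i] X(2)[of j] L(2)[of i]
      unfolding norm2_parallelogram[OF XL2 XL2] s_def by blast
  qed
  have "\<exists>N. \<forall>i\<ge>N. \<forall>j\<ge>N. norm2 (\<lambda>z. X i z - X j z) < e" if "e > 0" for e
  proof -
    have "\<forall>\<^sub>F j in sequentially. s j < e^2"
      using order_tendstoD(2)[OF s, of "e^2"] that by simp
    then obtain N where N: "\<And>j. j \<ge> N \<Longrightarrow> s j < e^2"
      by (auto simp: eventually_sequentially)
    have *: "norm2 (\<lambda>z. X i z - X j z) < e" if "N \<le> j" "j \<le> i" for i j
      using est[OF that(2)] N[OF that(1)] \<open>e > 0\<close> by (intro power2_less_imp_less[of _ e]) auto
    have "norm2 (\<lambda>z. X i z - X j z) < e" if "N \<le> i" "N \<le> j" for i j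
      using *[of j i] *[of i j] that norm2_minus_commute[of "X i" "X j"] by (cases "j \<le> i") auto
    then show ?thesis by blast
  qed
  from L2_complete[OF XL2 this] obtain x where x: "x \<in> L2" "l2_conv X x" by blast
  show ?thesis
  proof (rule that[OF X(1) x])
    fix y assume y: "\<And>j. y \<in> C j"
    have "(\<lambda>j. (norm2 (X j))^2) \<longlonglongrightarrow> (norm2 x)^2"
      by (intro tendsto_power l2_conv_norm2 x XL2)
    moreover have "(\<lambda>j. (norm2 y)^2 + 1 / Suc j) \<longlonglongrightarrow> (norm2 y)^2 + 0"
      by (intro tendsto_intros LIMSEQ_Suc[OF lim_1_over_n])
    moreover have "(norm2 (X j))^2 \<le> (norm2 y)^2 + 1 / Suc j" for j
      using X(2)[of j] m_le[OF y, of j] by linarith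
    ultimately have "(norm2 x)^2 \<le> (norm2 y)^2"
      by (intro LIMSEQ_le[where X="\<lambda>j. (norm2 (X j))^2" and Y="\<lambda>j. (norm2 y)^2 + 1 / Suc j"]) auto
    then show "norm2 x \<le> norm2 y" by (rule power2_le_imp_le) simp
  qed
qed

text \<open>The inequality is the first-order condition for minimality of the norm along the segment
  from x to y. The set is not assumed closed, so x is only a limit of members X j; arbitrary convex
  weights are required because the weight of y tends to 0.\<close>

lemma convex_minimal_norm:
  fixes C :: "(complex^'n::finite \<Rightarrow> complex) set"
  assumes L2: "C \<subseteq> L2" and ne: "C \<noteq> {}"
    and convex: "\<And>u v t. u \<in> C \<Longrightarrow> v \<in> C \<Longrightarrow> 0 \<le> t \<Longrightarrow> t \<le> 1 \<Longrightarrow>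
      (\<lambda>z. complex_of_real (1 - t) * u z + complex_of_real t * v z) \<in> C"
  obtains X x where "\<And>j. X j \<in> C" "x \<in> L2" "l2_conv X x"
    "\<And>y. y \<in> C \<Longrightarrow> (norm2 x)^2 \<le> Re (l2_inner y x)"
proof -
  obtain u0 where u0: "u0 \<in> C" using ne by blast
  have mid: "(\<lambda>z. (u z + v z) / 2) \<in> C" if "u \<in> C" "v \<in> C" for u v
    using convex[OF that, of "1/2"] by (simp add: add_divide_distrib)
  obtain X x where X: "\<And>j. X j \<in> C" "x \<in> L2" "l2_conv X x" "\<And>y. y \<in> C \<Longrightarrow> norm2 x \<le> norm2 y"
  proof (rule nested_convex_l2_conv[of "\<lambda>_. C" "norm2 u0"])
    show "\<exists>u\<in>C. norm2 u \<le> norm2 u0" using u0 by blast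
  qed (use L2 mid in auto)
  have XL2: "X j \<in> L2" for j using X(1) L2 by blast
  show ?thesis
  proof (rule that[OF X(1-3)])
    fix y assume y: "y \<in> C"
    then have yL2: "y \<in> L2" using L2 by blast
    define d where "d z = y z - x z" for z
    have d: "d \<in> L2" unfolding d_def[abs_def] by (intro L2_diff yL2 X)
    have ineq: "0 \<le> 2 * Re (l2_inner d x) + t * (norm2 d)^2" if t: "0 < t" "t \<le> 1" for t
    proof -
      \<comment> \<open>The point w on the segment need not belong to C, since x need not.
        Minimality is therefore tested on the nearby points Y j of C and carried over to w in the
        limit.\<close>
      define Y where "Y j z = complex_of_real (1 - t) * X j z + complex_of_real t * y z" for j z
      define w where "w z = complex_of_real (1 - t) * x z + complex_of_real t * y z" for z
      have YC: "Y j \<in> C" for j unfolding Y_def[abs_def] using t by (intro convex X y) auto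
      have w: "w \<in> L2" unfolding w_def[abs_def] by (intro L2_add L2_cmult X yL2)
      have "(\<lambda>z. Y j z - w z) = (\<lambda>z. complex_of_real (1 - t) * (X j z - x z))" for j
        by (auto simp: Y_def w_def algebra_simps)
      then have "l2_conv Y w"
        using X(3) by (auto simp: l2_conv_def norm2_cmult simp del: of_real_diff intro: tendsto_mult_right_zero)
      then have "(\<lambda>j. norm2 (Y j)) \<longlonglongrightarrow> norm2 w"
        using YC L2 w by (intro l2_conv_norm2) auto
      then have "norm2 x \<le> norm2 w"
        using X(4)[OF YC] by (intro LIMSEQ_le_const) auto
      then have "(norm2 x)^2 \<le> (norm2 w)^2" by (intro power_mono) auto
      also have "w = (\<lambda>z. complex_of_real t * d z + x z)"
        by (auto simp: w_def d_def algebra_simps)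
      finally have "(norm2 x)^2 \<le> (t * norm2 d)^2 + 2 * (t * Re (l2_inner d x)) + (norm2 x)^2"
        using t unfolding norm2_add_square[OF L2_cmult[OF d] X(2)] norm2_cmult l2_inner_cmult_left
        by simp
      then have "0 \<le> t * (2 * Re (l2_inner d x) + t * (norm2 d)^2)"
        by (simp add: algebra_simps power2_eq_square)
      then show ?thesis using t by (simp add: zero_le_mult_iff)
    qed
    \<comment> \<open>The weight is t = 1/(n+1): it lies in (0,1] for every n and removes the
      quadratic term in the limit.\<close>
    have "(\<lambda>n. 2 * Re (l2_inner d x) + (1 / Suc n) * (norm2 d)^2) \<longlonglongrightarrow> 2 * Re (l2_inner d x) + 0 * (norm2 d)^2"
      by (intro tendsto_intros LIMSEQ_Suc[OF lim_1_over_n])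
    moreover have "0 \<le> 2 * Re (l2_inner d x) + (1 / Suc n) * (norm2 d)^2" for n
      by (rule ineq) auto
    ultimately have "0 \<le> 2 * Re (l2_inner d x) + 0 * (norm2 d)^2"
      by (intro LIMSEQ_le_const) auto
    moreover have "l2_inner d x = l2_inner y x - of_real ((norm2 x)^2)"
      unfolding d_def[abs_def] by (subst l2_inner_diff_left) (auto intro: yL2 X simp: l2_inner_self)
    ultimately show "(norm2 x)^2 \<le> Re (l2_inner y x)" by simp
  qed
qed

text \<open>A one-sided bound over all complex multiples forces vanishing. This turns a variational
  inequality along a linear subspace into orthogonality.\<close>

lemma eq_0_if_Re_mult_bounded_below:
  fixes a :: complex
  assumes "\<And>c. B \<le> Re (c * a)" shows "a = 0"
proof (rule ccontr)
  assume "a \<noteq> 0"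
  then have "Re ((of_real (B - 1) / a) * a) = B - 1" by simp
  with assms[of "of_real (B - 1) / a"] show False by simp
qed

text \<open>The set S - u is convex, and its element of least norm is s - u with s the orthogonal
  projection of u on the closure of S. Since S contains all multiples of t, the variational
  inequality becomes an orthogonality relation. Closedness of S is not assumed, so membership of s
  in S has to be recovered from the approximating sequence where it is wanted.\<close>

lemma l2_projection:
  fixes S :: "(complex^'n::finite \<Rightarrow> complex) set"
  assumes S: "S \<subseteq> L2" "S \<noteq> {}"
    and add: "\<And>u v. u \<in> S \<Longrightarrow> v \<in> S \<Longrightarrow> (\<lambda>z. u z + v z) \<in> S"
    and cmult: "\<And>u c. u \<in> S \<Longrightarrow> (\<lambda>z. c * u z) \<in> S"
    and u: "u \<in> L2"
  obtains Y s where "\<And>j. Y j \<in> S" "s \<in> L2" "l2_conv Y s"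
    "\<And>t. t \<in> S \<Longrightarrow> l2_inner t (\<lambda>z. u z - s z) = 0"
proof -
  define C where "C = (\<lambda>t z. t z - u z) ` S"
  have "C \<subseteq> L2" "C \<noteq> {}" using S u by (auto simp: C_def intro: L2_diff)
  moreover have "(\<lambda>z. complex_of_real (1 - r) * v z + complex_of_real r * w z) \<in> C"
    if vw: "v \<in> C" "w \<in> C" for v w r
  proof -
    obtain s t where st: "s \<in> S" "t \<in> S" "v = (\<lambda>z. s z - u z)" "w = (\<lambda>z. t z - u z)"
      using vw unfolding C_def by blast
    have "(\<lambda>z. complex_of_real (1 - r) * s z + complex_of_real r * t z) \<in> S"
      by (intro add cmult st)
    then show ?thesis unfolding C_def
      by (rule rev_image_eqI) (simp add: st fun_eq_iff algebra_simps)
  qed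
  ultimately obtain X x where X: "\<And>j. X j \<in> C" "x \<in> L2" "l2_conv X x"
    "\<And>y. y \<in> C \<Longrightarrow> (norm2 x)^2 \<le> Re (l2_inner y x)"
    by (rule convex_minimal_norm) (auto simp del: of_real_diff)
  have "\<exists>t\<in>S. X j = (\<lambda>z. t z - u z)" for j using X(1)[of j] by (auto simp: C_def)
  then obtain Y where Y: "\<And>j. Y j \<in> S" "\<And>j. X j = (\<lambda>z. Y j z - u z)" by metis
  define s where "s z = u z + x z" for z
  show ?thesis
  proof (rule that[OF Y(1)])
    show "s \<in> L2" unfolding s_def[abs_def] by (intro L2_add u X)
    show "l2_conv Y s" using X(3) by (simp add: l2_conv_def Y s_def algebra_simps)
    fix t assume t: "t \<in> S"
    then have tL2: "t \<in> L2" using S by auto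
    have "(norm2 x)^2 + Re (l2_inner u x) \<le> Re (c * l2_inner t x)" for c
    proof -
      have "(\<lambda>z. c * t z - u z) \<in> C" unfolding C_def using cmult[OF t, of c] by (rule rev_image_eqI) simp
      from X(4)[OF this] show ?thesis
        by (simp add: l2_inner_diff_left L2_cmult tL2 u X l2_inner_cmult_left)
    qed
    then have "l2_inner t x = 0" by (rule eq_0_if_Re_mult_bounded_below)
    moreover have "l2_inner t (\<lambda>z. u z - s z) = - l2_inner t x"
      by (simp add: s_def l2_inner_def)
    ultimately show "l2_inner t (\<lambda>z. u z - s z) = 0" by simp
  qed
qed

subsection \<open>Uniqueness of Fourier coefficients\<close>

text \<open>The uniqueness proof shows that this class is stable under multiplication by polynomials
  in the real coordinates. Integrability is what the passage from polynomials to continuous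
  functions and to indicators uses.\<close>

definition fourier_null :: "(complex^'n::finite \<Rightarrow> complex) set" where
  "fourier_null = {u. integrable torus_measure u \<and> (\<forall>k. fourier_coeff u k = 0)}"

lemma integrable_mult_monom_pow:
  assumes "integrable torus_measure u"
  shows "integrable torus_measure (\<lambda>z. monom_pow k z * u z)"
    and "integrable torus_measure (\<lambda>z. u z * cnj (monom_pow k z))"
proof -
  have [measurable]: "u \<in> borel_measurable borel" using assms by auto
  have A: "AE z in torus_measure. norm (monom_pow k z * u z) \<le> norm (u z)"
    "AE z in torus_measure. norm (u z * cnj (monom_pow k z)) \<le> norm (u z)"
    using AE_torus by (eventually_elim, simp add: norm_mult norm_monom_pow_torus)+
  show "integrable torus_measure (\<lambda>z. monom_pow k z * u z)"
    by (rule Bochner_Integration.integrable_bound[OF assms _ A(1)]) simp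
  show "integrable torus_measure (\<lambda>z. u z * cnj (monom_pow k z))"
    by (rule Bochner_Integration.integrable_bound[OF assms _ A(2)]) (simp, measurable)
qed

lemma fourier_null_cong:
  assumes "u \<in> fourier_null" "v \<in> borel_measurable borel" "AE z in torus_measure. v z = u z"
  shows "v \<in> fourier_null"
proof -
  have u: "integrable torus_measure u" "\<And>k. fourier_coeff u k = 0"
    using assms(1) by (auto simp: fourier_null_def)
  have [measurable]: "u \<in> borel_measurable borel" "v \<in> borel_measurable borel" using u assms by auto
  have "integrable torus_measure v"
    using u(1) assms by (subst integrable_cong_AE[where g=u]) auto
  moreover have "fourier_coeff v k = fourier_coeff u k" for k
    unfolding fourier_coeff_def
  proof (rule integral_cong_AE)
    show "AE z in torus_measure. v z * cnj (monom_pow k z) = u z * cnj (monom_pow k z)"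
      using assms(3) by eventually_elim simp
  qed measurable
  ultimately show ?thesis by (simp add: fourier_null_def u)
qed

lemma fourier_null_add:
  "u \<in> fourier_null \<Longrightarrow> v \<in> fourier_null \<Longrightarrow> (\<lambda>z. u z + v z) \<in> fourier_null"
  by (simp add: fourier_null_def fourier_coeff_def distrib_right integrable_mult_monom_pow)

lemma fourier_null_cmult: "u \<in> fourier_null \<Longrightarrow> (\<lambda>z. c * u z) \<in> fourier_null"
  by (simp add: fourier_null_def fourier_coeff_def mult.assoc)

lemma fourier_null_sum:
  "(\<And>i. i \<in> I \<Longrightarrow> u i \<in> fourier_null) \<Longrightarrow> (\<lambda>z. \<Sum>i\<in>I. u i z) \<in> fourier_null"
proof (induction I rule: infinite_finite_induct)
  case (insert i I)
  then show ?case by (simp add: fourier_null_add)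
qed (auto simp: fourier_null_def fourier_coeff_def)

lemma fourier_null_monom_pow:
  assumes "u \<in> fourier_null" shows "(\<lambda>z. monom_pow l z * u z) \<in> fourier_null"
proof -
  have u: "integrable torus_measure u" "\<And>k. fourier_coeff u k = 0"
    using assms by (auto simp: fourier_null_def)
  have [measurable]: "u \<in> borel_measurable borel" using u by auto
  have "fourier_coeff (\<lambda>z. monom_pow l z * u z) k = fourier_coeff u (k - l)" for k
    unfolding fourier_coeff_def
  proof (rule integral_cong_AE)
    show "AE z in torus_measure. monom_pow l z * u z * cnj (monom_pow k z) = u z * cnj (monom_pow (k - l) z)"
      using AE_torus
    proof eventually_elim
      case (elim z)
      have "monom_pow (k - l) z = monom_pow k z * cnj (monom_pow l z)"
        using monom_pow_add[OF elim, of k "-l"] by (simp add: monom_pow_uminus[OF elim])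
      then show ?case by simp
    qed
  qed measurable
  with u show ?thesis by (simp add: fourier_null_def integrable_mult_monom_pow)
qed

text \<open>The Stone-Weierstrass theorem delivers polynomials generated by real-linear functionals.
  On the torus the conjugate of z_j is the monomial with exponent -1, so such functionals are
  trigonometric polynomials of degree one.\<close>

lemma bounded_linear_torus_expansion:
  fixes p :: "complex^'n::finite \<Rightarrow> real"
  assumes "bounded_linear p"
  obtains a where "\<And>z. z \<in> torus \<Longrightarrow> complex_of_real (p z)
    = (\<Sum>j\<in>UNIV. a j * monom_pow (axis j 1) z + cnj (a j) * monom_pow (- axis j 1) z)"
proof -
  interpret p: bounded_linear p by fact
  have mono: "monom_pow (axis j 1) z = z $ j" for j and z :: "complex^'n"
  proof -
    have "monom_pow (axis j 1) z = (\<Prod>i\<in>UNIV. if i = j then z $ j else 1)"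
      unfolding monom_pow_def by (rule prod.cong) (auto simp: axis_def)
    then show ?thesis by simp
  qed
  \<comment> \<open>Chosen so that 2 Re(a_j z_j) = Re(z_j) p(e_j) + Im(z_j) p(i e_j).\<close>
  define a where "a j = (complex_of_real (p (axis j 1)) - \<i> * complex_of_real (p (axis j \<i>))) / 2" for j
  show ?thesis
  proof (rule that[of a])
    fix z :: "complex^'n" assume z: "z \<in> torus"
    have "z = (\<Sum>j\<in>UNIV. Re (z $ j) *\<^sub>R axis j 1 + Im (z $ j) *\<^sub>R axis j \<i>)"
    proof (subst vec_eq_iff, rule allI)
      fix i
      have "(\<Sum>j\<in>UNIV. Re (z $ j) *\<^sub>R axis j 1 + Im (z $ j) *\<^sub>R axis j \<i>) $ i
        = (\<Sum>j\<in>UNIV. if j = i then z $ j else 0)"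
        unfolding sum_component by (rule sum.cong) (auto simp: axis_def complex_eq_iff)
      then show "z $ i = (\<Sum>j\<in>UNIV. Re (z $ j) *\<^sub>R axis j 1 + Im (z $ j) *\<^sub>R axis j \<i>) $ i"
        by simp
    qed
    then have "p z = p (\<Sum>j\<in>UNIV. Re (z $ j) *\<^sub>R axis j 1 + Im (z $ j) *\<^sub>R axis j \<i>)"
      by (rule arg_cong)
    also have "\<dots> = (\<Sum>j\<in>UNIV. Re (z $ j) * p (axis j 1) + Im (z $ j) * p (axis j \<i>))"
      by (simp add: p.sum p.add p.scaleR)
    finally have "complex_of_real (p z)
      = (\<Sum>j\<in>UNIV. complex_of_real (Re (z $ j) * p (axis j 1) + Im (z $ j) * p (axis j \<i>)))"
      by (simp only: of_real_sum)
    also have "\<dots> = (\<Sum>j\<in>UNIV. a j * monom_pow (axis j 1) z + cnj (a j) * monom_pow (- axis j 1) z)"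
      by (rule sum.cong) (auto simp: monom_pow_uminus[OF z] mono a_def complex_eq_iff field_simps)
    finally show "complex_of_real (p z)
      = (\<Sum>j\<in>UNIV. a j * monom_pow (axis j 1) z + cnj (a j) * monom_pow (- axis j 1) z)" .
  qed
qed

text \<open>Multiplication by a monomial merely shifts Fourier coefficients, which settles linear
  factors. Keeping u arbitrary in the induction lets the product case apply the two hypotheses one
  after the other.\<close>

lemma fourier_null_polynomial:
  fixes p :: "complex^'n::finite \<Rightarrow> real"
  assumes "real_polynomial_function p" "u \<in> fourier_null"
  shows "(\<lambda>z. complex_of_real (p z) * u z) \<in> fourier_null"
  using assms
proof (induction arbitrary: u rule: real_polynomial_function.induct)
  case (linear p)
  obtain a where a: "\<And>z. z \<in> torus \<Longrightarrow> complex_of_real (p z)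
    = (\<Sum>j\<in>UNIV. a j * monom_pow (axis j 1) z + cnj (a j) * monom_pow (- axis j 1) z)"
    using bounded_linear_torus_expansion[OF linear(1)] by blast
  have [measurable]: "u \<in> borel_measurable borel"
    using linear by (auto simp: fourier_null_def)
  have [measurable]: "p \<in> borel_measurable borel"
    using linear(1) by (intro borel_measurable_continuous_onI linear_continuous_on)
  show ?case
  proof (rule fourier_null_cong)
    show "(\<lambda>z. \<Sum>j\<in>UNIV. a j * (monom_pow (axis j 1) z * u z)
        + cnj (a j) * (monom_pow (- axis j 1) z * u z)) \<in> fourier_null"
      by (intro fourier_null_sum fourier_null_add fourier_null_cmult fourier_null_monom_pow linear)
    show "AE z in torus_measure. complex_of_real (p z) * u z = (\<Sum>j\<in>UNIV. a j * (monom_pow (axis j 1) z * u z)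
        + cnj (a j) * (monom_pow (- axis j 1) z * u z))"
      using AE_torus by eventually_elim (simp add: a sum_distrib_right distrib_right mult.assoc)
  qed measurable
next
  case (const c) then show ?case by (intro fourier_null_cmult)
next
  case (add f g)
  then show ?case by (simp add: distrib_right fourier_null_add)
next
  case (mult f g)
  then have "(\<lambda>z. complex_of_real (f z) * (complex_of_real (g z) * u z)) \<in> fourier_null" by blast
  then show ?case by (simp add: mult.assoc)
qed

lemma fourier_null_integral:
  assumes "u \<in> fourier_null" shows "integral\<^sup>L torus_measure u = 0"
proof -
  have "fourier_coeff u 0 = 0" using assms by (simp add: fourier_null_def)
  then show ?thesis by (simp add: fourier_coeff_def)
qed

text \<open>Only values on the compact torus matter, where a polynomial p is uniformly within e of
  g. The product p u integrates to 0, so the integral is at most e times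
  \<open>norm1 u\<close>.\<close>

lemma fourier_null_integral_continuous:
  fixes g :: "complex^'n::finite \<Rightarrow> real"
  assumes u: "u \<in> fourier_null" and g: "continuous_on UNIV g"
  shows "integral\<^sup>L torus_measure (\<lambda>z. complex_of_real (g z) * u z) = 0"
proof -
  have int: "integrable torus_measure u" using u by (simp add: fourier_null_def)
  have [measurable]: "u \<in> borel_measurable borel" "g \<in> borel_measurable borel"
    using int g by (auto intro: borel_measurable_continuous_onI)
  have le: "cmod (integral\<^sup>L torus_measure (\<lambda>z. complex_of_real (g z) * u z)) \<le> e * norm1 u" if e: "e > 0" for e
  proof -
    obtain p where p: "real_polynomial_function p" "\<And>z. z \<in> torus \<Longrightarrow> \<bar>g z - p z\<bar> < e"
      using Stone_Weierstrass_real_polynomial_function[OF compact_torus continuous_on_subset[OF g subset_UNIV] e]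
      by blast
    have pu: "(\<lambda>z. complex_of_real (p z) * u z) \<in> fourier_null"
      by (rule fourier_null_polynomial[OF p(1) u])
    have pint: "integrable torus_measure (\<lambda>z. complex_of_real (p z) * u z)"
      using pu by (simp add: fourier_null_def)
    have [measurable]: "p \<in> borel_measurable borel"
      using p(1) by (intro borel_measurable_continuous_onI continuous_at_imp_continuous_on)
        (auto intro: continuous_real_polymonial_function)
    let ?d = "\<lambda>z. complex_of_real (g z - p z) * u z"
    have d: "AE z in torus_measure. norm (?d z) \<le> e * norm (u z)"
      using AE_torus
    proof eventually_elim
      case (elim z)
      have "norm (?d z) = \<bar>g z - p z\<bar> * norm (u z)" by (simp only: norm_mult norm_of_real)
      then show ?case using p(2)[OF elim] by (simp add: mult_right_mono)
    qed
    have eint: "integrable torus_measure (\<lambda>z. e * norm (u z))"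
      using int by simp
    have dint: "integrable torus_measure ?d"
      by (rule Bochner_Integration.integrable_bound[OF eint]) (use d e in auto)
    have "integral\<^sup>L torus_measure (\<lambda>z. complex_of_real (g z) * u z)
        = integral\<^sup>L torus_measure (\<lambda>z. ?d z + complex_of_real (p z) * u z)"
      by (simp add: algebra_simps)
    also have "\<dots> = integral\<^sup>L torus_measure ?d"
      using fourier_null_integral[OF pu] by (subst Bochner_Integration.integral_add[OF dint pint]) simp
    finally have "cmod (integral\<^sup>L torus_measure (\<lambda>z. complex_of_real (g z) * u z)) = cmod (integral\<^sup>L torus_measure ?d)"
      by simp
    also have "\<dots> \<le> integral\<^sup>L torus_measure (\<lambda>z. e * norm (u z))"
      using order_trans[OF integral_norm_bound integral_mono_AE[OF integrable_norm[OF dint] eint d]] .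
    finally show ?thesis by (simp add: norm1_def)
  qed
  have "(\<lambda>n. (1 / Suc n) * norm1 u) \<longlonglongrightarrow> 0 * norm1 u"
    by (intro tendsto_intros LIMSEQ_Suc[OF lim_1_over_n])
  moreover have "cmod (integral\<^sup>L torus_measure (\<lambda>z. complex_of_real (g z) * u z)) \<le> (1 / Suc n) * norm1 u" for n
    by (rule le) simp
  ultimately have "cmod (integral\<^sup>L torus_measure (\<lambda>z. complex_of_real (g z) * u z)) \<le> 0 * norm1 u"
    by (intro LIMSEQ_le_const) auto
  then show ?thesis by simp
qed

lemma fourier_null_integral_closed:
  fixes C :: "(complex^'n::finite) set"
  assumes u: "u \<in> fourier_null" and C: "closed C"
  shows "integral\<^sup>L torus_measure (\<lambda>z. indicator C z *\<^sub>R u z) = 0"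
\<comment> \<open>The empty set is separated because \<open>infdist z {}\<close> is 0 by convention,
  so the functions below would be constantly 1 instead of approximating its indicator.\<close>
proof (cases "C = {}")
  case False
  have int: "integrable torus_measure u" using u by (simp add: fourier_null_def)
  have [measurable]: "u \<in> borel_measurable borel" using int by auto
  have [measurable]: "C \<in> sets borel" using C by auto
  \<comment> \<open>These continuous functions equal 1 on C and are eventually 0 at each point off
    the closed set C, so they converge to the indicator of C with values in [0,1].\<close>
  define g where "g n z = max 0 (1 - real n * infdist z C)" for n z
  have gc: "continuous_on UNIV (g n)" for n
    unfolding g_def by (intro continuous_intros)
  then have [measurable]: "g n \<in> borel_measurable borel" for n
    by (rule borel_measurable_continuous_onI)
  have "(\<lambda>n. integral\<^sup>L torus_measure (\<lambda>z. complex_of_real (g n z) * u z))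
      \<longlonglongrightarrow> integral\<^sup>L torus_measure (\<lambda>z. indicator C z *\<^sub>R u z)"
  proof (rule integral_dominated_convergence[where w="\<lambda>z. norm (u z)"])
    show "AE z in torus_measure. (\<lambda>n. complex_of_real (g n z) * u z) \<longlonglongrightarrow> indicator C z *\<^sub>R u z"
    proof (rule AE_I2)
      fix z
      have "(\<lambda>n. g n z) \<longlonglongrightarrow> indicator C z"
      proof (cases "z \<in> C")
        case True then show ?thesis by (simp add: g_def)
      next
        case nz: False
        then have pos: "infdist z C > 0"
          using C False by (simp add: in_closed_iff_infdist_zero infdist_nonneg less_le)
        obtain N :: nat where N: "1 < real N * infdist z C"
          using reals_Archimedean3[OF pos] by blast
        have "g n z = 0" if "n \<ge> N" for n
        proof -
          have "real N * infdist z C \<le> real n * infdist z C"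
            using that pos by (intro mult_right_mono) auto
          with N show ?thesis by (simp add: g_def)
        qed
        then have "\<forall>\<^sub>F n in sequentially. g n z = indicator C z"
          using nz by (auto simp: eventually_sequentially)
        then show ?thesis by (rule tendsto_eventually)
      qed
      then have "(\<lambda>n. complex_of_real (g n z) * u z) \<longlonglongrightarrow> complex_of_real (indicator C z) * u z"
        by (intro tendsto_intros)
      then show "(\<lambda>n. complex_of_real (g n z) * u z) \<longlonglongrightarrow> indicator C z *\<^sub>R u z"
        by (simp add: scaleR_conv_of_real)
    qed
    show "AE z in torus_measure. norm (complex_of_real (g n z) * u z) \<le> norm (u z)" for n
      by (rule AE_I2) (auto simp: norm_mult g_def infdist_nonneg intro!: mult_left_le_one_le)
  qed (use int in auto)
  moreover have "integral\<^sup>L torus_measure (\<lambda>z. complex_of_real (g n z) * u z) = 0" for n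
    by (rule fourier_null_integral_continuous[OF u gc])
  ultimately show ?thesis by (simp add: LIMSEQ_const_iff)
qed simp

text \<open>Closed sets are stable under intersection and generate the Borel sets; sets over which u
  integrates to 0 are stable under complements and disjoint countable unions. This is Dynkin's
  argument.\<close>

lemma fourier_null_integral_borel:
  fixes A :: "(complex^'n::finite) set"
  assumes u: "u \<in> fourier_null" and A: "A \<in> sets borel"
  shows "integral\<^sup>L torus_measure (\<lambda>z. indicator A z *\<^sub>R u z) = 0"
proof -
  have int: "integrable torus_measure u" using u by (simp add: fourier_null_def)
  have ind: "integrable torus_measure (\<lambda>z. indicator B z *\<^sub>R u z)" if "B \<in> sets borel" for B
    using that int by (intro integrable_mult_indicator) auto
  have "Int_stable {S :: (complex^'n) set. closed S}"
    by (auto simp: Int_stable_def)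
  moreover have "{S :: (complex^'n) set. closed S} \<subseteq> Pow UNIV"
    by simp
  moreover have "A \<in> sigma_sets UNIV {S. closed S}"
    using A by (simp add: borel_eq_closed)
  ultimately show ?thesis
  proof (induction rule: sigma_sets_induct_disjoint)
    case (basic B)
    then show ?case using fourier_null_integral_closed[OF u] by simp
  next
    case empty show ?case by simp
  next
    case (compl B)
    then have B: "B \<in> sets borel" by (simp add: borel_eq_closed)
    have "(\<lambda>z. indicator (UNIV - B) z *\<^sub>R u z) = (\<lambda>z. u z - indicator B z *\<^sub>R u z)"
      by (auto simp: indicator_def)
    then show ?case
      using compl fourier_null_integral[OF u] int ind[OF B] by simp
  next
    case (union B)
    have B: "B i \<in> sets borel" for i using union by (auto simp: borel_eq_closed)
    have "integral\<^sup>L torus_measure (\<lambda>z. indicator (\<Union>i. B i) z *\<^sub>R u z)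
       = (\<Sum>i. integral\<^sup>L torus_measure (\<lambda>z. indicator (B i) z *\<^sub>R u z))"
      using union(1) B ind[of "\<Union>i. B i"]
      by (intro lebesgue_integral_countable_add[unfolded set_lebesgue_integral_def set_integrable_def])
         (auto simp: disjoint_family_on_def)
    then show ?case using union by simp
  qed
qed

lemma fourier_null_AE_zero:
  fixes u :: "complex^'n::finite \<Rightarrow> complex"
  assumes u: "u \<in> fourier_null" shows "AE z in torus_measure. u z = 0"
proof -
  have int: "integrable torus_measure u" using u by (simp add: fourier_null_def)
  have ind: "integrable torus_measure (\<lambda>z. indicator A z *\<^sub>R u z)" if "A \<in> sets borel" for A
    using that int by (intro integrable_mult_indicator) auto
  have "AE z in torus_measure. Re (u z) = 0"
  proof (rule density_unique_real)
    fix A :: "(complex^'n) set" assume "A \<in> sets torus_measure"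
    then show "set_lebesgue_integral torus_measure A (\<lambda>z. Re (u z)) = set_lebesgue_integral torus_measure A (\<lambda>_. 0)"
      using integral_Re[OF ind[of A]] fourier_null_integral_borel[OF u, of A]
      by (simp add: set_lebesgue_integral_def)
  qed (use int in auto)
  moreover have "AE z in torus_measure. Im (u z) = 0"
  proof (rule density_unique_real)
    fix A :: "(complex^'n) set" assume "A \<in> sets torus_measure"
    then show "set_lebesgue_integral torus_measure A (\<lambda>z. Im (u z)) = set_lebesgue_integral torus_measure A (\<lambda>_. 0)"
      using integral_Im[OF ind[of A]] fourier_null_integral_borel[OF u, of A]
      by (simp add: set_lebesgue_integral_def)
  qed (use int in auto)
  ultimately show ?thesis
    by eventually_elim (simp add: complex_eq_iff)
qed

lemma fourier_coeff_zero_AE_zero: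
  "u \<in> L2 \<Longrightarrow> (\<And>k. fourier_coeff u k = 0) \<Longrightarrow> AE z in torus_measure. u z = 0"
  by (rule fourier_null_AE_zero) (simp add: fourier_null_def L2_integrable)

section \<open>Density of trigonometric polynomials with prescribed exponents\<close>

inductive_set trig_span :: "(int^'n::finite) set \<Rightarrow> (complex^'n \<Rightarrow> complex) set" for I where
  zero: "(\<lambda>z. 0) \<in> trig_span I"
| step: "k \<in> I \<Longrightarrow> p \<in> trig_span I \<Longrightarrow> (\<lambda>z. c * monom_pow k z + p z) \<in> trig_span I"

lemma trig_span_L2: "p \<in> trig_span I \<Longrightarrow> p \<in> L2"
  by (induction rule: trig_span.induct) (auto intro!: L2_const L2_add L2_cmult L2_monom_pow)

lemma trig_span_add: "p \<in> trig_span I \<Longrightarrow> q \<in> trig_span I \<Longrightarrow> (\<lambda>z. p z + q z) \<in> trig_span I"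
  by (induction rule: trig_span.induct) (auto simp: add.assoc intro: trig_span.step)

lemma trig_span_cmult: "p \<in> trig_span I \<Longrightarrow> (\<lambda>z. c * p z) \<in> trig_span I"
proof (induction rule: trig_span.induct)
  case (step k p d)
  then show ?case using trig_span.step[OF step(1,3), of "c * d"] by (simp add: distrib_left mult.assoc)
qed (auto intro: trig_span.zero)

lemma trig_span_monom_pow: "k \<in> I \<Longrightarrow> monom_pow k \<in> trig_span I"
  using trig_span.step[OF _ trig_span.zero, of k I 1] by simp

lemma fourier_coeff_monom_pow: "fourier_coeff (monom_pow l) k = (if k = l then 1 else 0)"
proof -
  have "fourier_coeff (monom_pow l) k = integral\<^sup>L torus_measure (monom_pow (l - k))"
    unfolding fourier_coeff_def
  proof (rule integral_cong_AE)
    show "AE z in torus_measure. monom_pow l z * cnj (monom_pow k z) = monom_pow (l - k) z"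
      using AE_torus
    proof eventually_elim
      case (elim z)
      then show ?case
        using monom_pow_add[OF elim, of l "-k"] by (simp add: monom_pow_uminus[OF elim])
    qed
  qed measurable
  then show ?thesis by (auto simp: integral_monom_pow)
qed

lemma fourier_coeff_trig_span:
  assumes "p \<in> trig_span I" "k \<notin> I" shows "fourier_coeff p k = 0"
  using assms
proof (induction rule: trig_span.induct)
  case (step l p c)
  then have "fourier_coeff (\<lambda>z. c * monom_pow l z + p z) k = c * fourier_coeff (monom_pow l) k + fourier_coeff p k"
    unfolding fourier_coeff_eq_inner
    by (subst l2_inner_add_left) (auto simp: l2_inner_cmult_left intro: L2_cmult L2_monom_pow trig_span_L2)
  with step show ?case by (auto simp: fourier_coeff_monom_pow)
qed (simp add: fourier_coeff_def)

text \<open>Let s be the projection of u on the closure of the span. The coefficients of u - s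
  vanish at exponents in I by orthogonality, and outside I because those of u and of all
  approximants vanish. Uniqueness of coefficients then gives s = u almost everywhere.\<close>

lemma L2_trig_approximation:
  assumes u: "u \<in> L2" and I: "\<And>k. k \<notin> I \<Longrightarrow> fourier_coeff u k = 0"
  obtains Y where "\<And>j. Y j \<in> trig_span I" "l2_conv Y u"
proof -
  obtain Y s where Y: "\<And>j. Y j \<in> trig_span I" "s \<in> L2" "l2_conv Y s"
    "\<And>t. t \<in> trig_span I \<Longrightarrow> l2_inner t (\<lambda>z. u z - s z) = 0"
  proof (rule l2_projection[of "trig_span I" u])
    show "trig_span I \<noteq> {}" using trig_span.zero by blast
  qed (auto intro: u trig_span_L2 trig_span_add trig_span_cmult)
  have us: "(\<lambda>z. u z - s z) \<in> L2" by (intro L2_diff u Y)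
  have "fourier_coeff (\<lambda>z. u z - s z) k = 0" for k
  proof (cases "k \<in> I")
    case True
    then show ?thesis
      using Y(4)[OF trig_span_monom_pow[OF True]]
      by (subst fourier_coeff_eq_inner, subst l2_inner_commute) simp
  next
    case False
    have "(\<lambda>j. l2_inner (Y j) (monom_pow k)) \<longlonglongrightarrow> l2_inner s (monom_pow k)"
      by (intro l2_conv_inner Y trig_span_L2[OF Y(1)] L2_monom_pow)
    moreover have "l2_inner (Y j) (monom_pow k) = 0" for j
      using fourier_coeff_trig_span[OF Y(1) False] by (simp add: fourier_coeff_eq_inner)
    ultimately have "l2_inner s (monom_pow k) = 0" by (simp add: LIMSEQ_const_iff)
    with I[OF False] show ?thesis
      unfolding fourier_coeff_eq_inner by (simp add: l2_inner_diff_left u Y L2_monom_pow)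
  qed
  then have ae: "AE z in torus_measure. u z - s z = 0"
    by (rule fourier_coeff_zero_AE_zero[OF us])
  have "norm2 (\<lambda>z. Y j z - u z) = norm2 (\<lambda>z. Y j z - s z)" for j
    by (rule norm2_cong_AE) (use ae in \<open>auto intro!: L2_diff u Y trig_span_L2[OF Y(1)]\<close>)
  then have "l2_conv Y u" using Y(3) by (simp add: l2_conv_def)
  with Y(1) show ?thesis by (rule that)
qed

subsection \<open>Boundary values and the analytic extension\<close>

definition nonneg_index :: "(int^'n::finite) set" where
  "nonneg_index = {k. \<forall>j. 0 \<le> k $ j}"

text \<open>Boxes exhaust the nonnegative exponents, so sums over them compute the unordered sum in
  \<open>analytic_ext\<close>; their product shape reduces geometric sums to one variable.\<close>

definition index_box :: "nat \<Rightarrow> (int^'n::finite) set" where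
  "index_box N = {k. \<forall>j. 0 \<le> k $ j \<and> k $ j \<le> int N}"

lemma index_box_subset: "index_box N \<subseteq> nonneg_index"
  by (auto simp: index_box_def nonneg_index_def)

lemma
  fixes f :: "'n::finite \<Rightarrow> int \<Rightarrow> real"
  shows finite_index_box: "finite (index_box N :: (int^'n) set)"
    and sum_index_box_prod: "(\<Sum>k\<in>index_box N. \<Prod>j\<in>UNIV. f j (k $ j)) = (\<Prod>j\<in>UNIV. \<Sum>i\<in>{0..int N}. f j i)"
proof -
  have im: "index_box N = vec_lambda ` (PiE (UNIV :: 'n set) (\<lambda>_. {0..int N}))"
  proof (intro set_eqI iffI)
    fix k :: "int^'n" assume "k \<in> index_box N"
    then show "k \<in> vec_lambda ` (PiE (UNIV :: 'n set) (\<lambda>_. {0..int N}))"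
      by (intro image_eqI[where x="vec_nth k"]) (auto simp: index_box_def)
  qed (auto simp: index_box_def PiE_iff)
  show "finite (index_box N :: (int^'n) set)"
    unfolding im by (intro finite_imageI finite_PiE) auto
  have inj: "inj_on (vec_lambda :: ('n \<Rightarrow> int) \<Rightarrow> int^'n) A" for A
    by (auto simp: inj_on_def vec_lambda_inject)
  have "(\<Sum>k\<in>index_box N. \<Prod>j\<in>UNIV. f j (k $ j)) = (\<Sum>g\<in>PiE UNIV (\<lambda>_. {0..int N}). \<Prod>j\<in>UNIV. f j (g j))"
    unfolding im by (subst sum.reindex[OF inj]) simp
  also have "\<dots> = (\<Prod>j\<in>UNIV. \<Sum>i\<in>{0..int N}. f j i)"
    by (rule prod_sum_PiE[symmetric]) auto
  finally show "(\<Sum>k\<in>index_box N. \<Prod>j\<in>UNIV. f j (k $ j)) = (\<Prod>j\<in>UNIV. \<Sum>i\<in>{0..int N}. f j i)" .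
qed

text \<open>The overlap of a box with its translate by -m still exhausts all nonnegative exponents.
  It is the index set produced by pairing the coefficient at m with the squared kernel
  below.\<close>

lemma filterlim_index_box_shift:
  assumes m: "m \<in> nonneg_index"
  shows "filterlim (\<lambda>N. {k \<in> index_box N. k + m \<in> index_box N}) (finite_subsets_at_top nonneg_index) sequentially"
  unfolding filterlim_finite_subsets_at_top
proof (intro allI impI)
  fix X :: "(int^'a) set" assume X: "finite X \<and> X \<subseteq> nonneg_index"
  define N where "N = (\<Sum>k\<in>X. \<Sum>j\<in>UNIV. nat (k $ j)) + (\<Sum>j\<in>UNIV. nat (m $ j))"
  have le: "k $ j + m $ j \<le> int N" if "k \<in> X" for k j
  proof -
    have "nat (k $ j) \<le> (\<Sum>j\<in>UNIV. nat (k $ j))" by (intro member_le_sum) auto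
    also have "\<dots> \<le> (\<Sum>k\<in>X. \<Sum>j\<in>UNIV. nat (k $ j))" using X that by (intro member_le_sum) auto
    finally have "nat (k $ j) \<le> (\<Sum>k\<in>X. \<Sum>j\<in>UNIV. nat (k $ j))" .
    moreover have "nat (m $ j) \<le> (\<Sum>j\<in>UNIV. nat (m $ j))" by (intro member_le_sum) auto
    ultimately show ?thesis unfolding N_def by linarith
  qed
  have "X \<subseteq> {k \<in> index_box n. k + m \<in> index_box n}" if "n \<ge> N" for n
  proof
    fix k assume k: "k \<in> X"
    have nn: "0 \<le> k $ j" "0 \<le> m $ j" for j using X k m by (auto simp: nonneg_index_def)
    have b: "k $ j + m $ j \<le> int n" for j using le[OF k, of j] that by linarith
    have "k $ j \<le> int n" for j using b[of j] nn(2)[of j] by linarith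
    with nn b show "k \<in> {k \<in> index_box n. k + m \<in> index_box n}"
      by (simp add: index_box_def)
  qed
  then show "\<forall>\<^sub>F n in sequentially. finite {k \<in> index_box n. k + m \<in> index_box n}
      \<and> X \<subseteq> {k \<in> index_box n. k + m \<in> index_box n} \<and> {k \<in> index_box n. k + m \<in> index_box n} \<subseteq> nonneg_index"
    using index_box_subset by (intro eventually_sequentiallyI[of N]) (auto simp: finite_index_box)
qed

lemma filterlim_index_box: "filterlim index_box (finite_subsets_at_top nonneg_index) sequentially"
  using filterlim_index_box_shift[of 0] by (simp add: nonneg_index_def)

lemma monom_pow_add_nonneg:
  assumes "k \<in> nonneg_index" "l \<in> nonneg_index"
  shows "monom_pow (k + l) z = monom_pow k z * monom_pow l z"
  using assms by (simp add: monom_pow_def nonneg_index_def power_int_def nat_add_distrib power_add prod.distrib)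

text \<open>Each box sum factors into one-variable geometric sums, hence is at most the product of
  the 1/(1 - |z_j|), and every finite set of nonnegative exponents lies in some box.\<close>

lemma summable_monom_pow:
  fixes z :: "complex^'n::finite"
  assumes "z \<in> polydisc" shows "(\<lambda>k. cmod (monom_pow k z)) summable_on nonneg_index"
proof (rule nonneg_bdd_above_summable_on)
  have r: "cmod (z $ j) < 1" for j using assms by (auto simp: polydisc_def)
  have geo: "(\<Sum>i\<in>{0..int N}. cmod (z $ j) powi i) \<le> 1 / (1 - cmod (z $ j))" for N j
  proof -
    have "(\<Sum>i\<in>{0..int N}. cmod (z $ j) powi i) = (\<Sum>i\<in>{..N}. cmod (z $ j) ^ i)"
      by (rule sum.reindex_bij_witness[of _ int nat]) (auto simp: power_int_def)
    also have "\<dots> \<le> (\<Sum>i. cmod (z $ j) ^ i)"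
      using r by (intro sum_le_suminf summable_geometric) auto
    finally show ?thesis using r by (simp add: suminf_geometric)
  qed
  have box: "(\<Sum>k\<in>index_box N. cmod (monom_pow k z)) \<le> (\<Prod>j\<in>UNIV. 1 / (1 - cmod (z $ j)))" for N
  proof -
    have "(\<Sum>k\<in>index_box N. cmod (monom_pow k z)) = (\<Prod>j\<in>UNIV. \<Sum>i\<in>{0..int N}. cmod (z $ j) powi i)"
      by (subst sum_index_box_prod[symmetric]) (simp add: monom_pow_def norm_power_int flip: prod_norm)
    also have "\<dots> \<le> (\<Prod>j\<in>UNIV. 1 / (1 - cmod (z $ j)))"
      by (intro prod_mono conjI geo sum_nonneg) auto
    finally show ?thesis .
  qed
  show "bdd_above (sum (\<lambda>k. cmod (monom_pow k z)) ` {F. F \<subseteq> nonneg_index \<and> finite F})"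
  proof (rule bdd_aboveI2)
    fix F :: "(int^'n) set" assume F: "F \<in> {F. F \<subseteq> nonneg_index \<and> finite F}"
    then have "\<forall>\<^sub>F N in sequentially. F \<subseteq> index_box N"
      using filterlim_index_box[unfolded filterlim_finite_subsets_at_top, rule_format, of F]
      by (auto elim: eventually_mono)
    then obtain N where "F \<subseteq> index_box N" by (auto simp: eventually_sequentially)
    then have "(\<Sum>k\<in>F. cmod (monom_pow k z)) \<le> (\<Sum>k\<in>index_box N. cmod (monom_pow k z))"
      by (intro sum_mono2 finite_index_box) auto
    also note box
    finally show "(\<Sum>k\<in>F. cmod (monom_pow k z)) \<le> (\<Prod>j\<in>UNIV. 1 / (1 - cmod (z $ j)))" .
  qed
qed simp

lemma norm2_monom_pow: "norm2 (monom_pow k) = 1"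
proof -
  have "complex_of_real ((norm2 (monom_pow k))^2) = 1"
    using fourier_coeff_monom_pow[of k k] by (simp only: fourier_coeff_eq_inner l2_inner_self) simp
  then have "(norm2 (monom_pow k))^2 = 1^2"
    by (simp only: of_real_eq_1_iff) simp
  then show ?thesis by (rule power2_eq_imp_eq) auto
qed

lemma norm_fourier_coeff_le: "u \<in> L2 \<Longrightarrow> cmod (fourier_coeff u k) \<le> norm2 u"
  using norm_l2_inner_le[OF _ L2_monom_pow, of u k] by (simp add: fourier_coeff_eq_inner norm2_monom_pow)

lemma fourier_series_abs_summable:
  assumes "u \<in> L2" "z \<in> polydisc"
  shows "(\<lambda>k. norm (fourier_coeff u k * monom_pow k z)) summable_on nonneg_index"
proof (rule summable_on_comparison_test)
  show "(\<lambda>k. norm2 u * cmod (monom_pow k z)) summable_on nonneg_index"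
    by (intro summable_on_cmult_right summable_monom_pow assms)
qed (auto simp: norm_mult intro!: mult_right_mono norm_fourier_coeff_le assms)

lemma analytic_ext_LIMSEQ:
  assumes "u \<in> L2" "z \<in> polydisc"
  shows "(\<lambda>N. \<Sum>k\<in>index_box N. fourier_coeff u k * monom_pow k z) \<longlonglongrightarrow> analytic_ext u z"
proof -
  have "(\<lambda>k. fourier_coeff u k * monom_pow k z) summable_on nonneg_index"
    using fourier_series_abs_summable[OF assms] by (rule abs_summable_summable)
  then have "(sum (\<lambda>k. fourier_coeff u k * monom_pow k z) \<longlongrightarrow> analytic_ext u z) (finite_subsets_at_top nonneg_index)"
    unfolding analytic_ext_def nonneg_index_def[symmetric] by (rule infsum_tendsto)
  from filterlim_compose[OF this filterlim_index_box] show ?thesis .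
qed

lemma analytic_ext_0: "analytic_ext u 0 = fourier_coeff u 0"
proof -
  have "infsum (\<lambda>k. fourier_coeff u k * monom_pow k 0) {k. \<forall>j. 0 \<le> k $ j}
      = infsum (\<lambda>k. fourier_coeff u k * monom_pow k 0) {0}"
  proof (rule infsum_cong_neutral)
    fix k :: "int^'a" assume "k \<in> {k. \<forall>j. 0 \<le> k $ j} - {0}"
    then obtain j where "k $ j \<noteq> 0" by (auto simp: vec_eq_iff)
    then have "(0 :: complex^'a) $ j powi (k $ j) = 0" by simp
    then have "monom_pow k (0 :: complex^'a) = 0" unfolding monom_pow_def by (intro prod_zero) auto
    then show "fourier_coeff u k * monom_pow k 0 = 0" by simp
  qed auto
  then show ?thesis by (simp add: analytic_ext_def)
qed

text \<open>Expanding |S_N|^2 gives a double sum over k and l in the box, involving the coefficient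
  of \<phi> at l - k. Only m = l - k \<ge> 0 contributes because \<phi> is in H^2, and then
  conj(z^k) z^(k+m) = z^m |z^k|^2, which separates the factor z^m from a positive weight.\<close>

lemma szego_kernel_identity:
  fixes z :: "complex^'n::finite"
  assumes \<phi>: "\<phi> \<in> H2"
  defines "S \<equiv> \<lambda>N w. \<Sum>k\<in>index_box N. cnj (monom_pow k z) * monom_pow k w"
  shows "integral\<^sup>L torus_measure (\<lambda>w. \<phi> w * complex_of_real ((cmod (S N w))^2))
    = (\<Sum>m\<in>index_box N. fourier_coeff \<phi> m * monom_pow m z
        * (\<Sum>k\<in>{k \<in> index_box N. k + m \<in> index_box N}. complex_of_real ((cmod (monom_pow k z))^2)))"
proof -
  let ?B = "index_box N :: (int^'n) set"
  have fin: "finite ?B" by (rule finite_index_box)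
  have \<phi>L2: "\<phi> \<in> L2" and \<phi>0: "\<And>k. k \<notin> nonneg_index \<Longrightarrow> fourier_coeff \<phi> k = 0"
    using \<phi> by (auto simp: H2_def nonneg_index_def not_le)
  have [measurable]: "\<phi> \<in> borel_measurable borel" using \<phi>L2 by (rule L2_measurable)
  have "integral\<^sup>L torus_measure (\<lambda>w. \<phi> w * complex_of_real ((cmod (S N w))^2))
     = integral\<^sup>L torus_measure (\<lambda>w. \<Sum>k\<in>?B. \<Sum>l\<in>?B. cnj (monom_pow k z) * monom_pow l z * (\<phi> w * cnj (monom_pow (l - k) w)))"
  proof (rule integral_cong_AE)
    show "AE w in torus_measure. \<phi> w * complex_of_real ((cmod (S N w))^2)
      = (\<Sum>k\<in>?B. \<Sum>l\<in>?B. cnj (monom_pow k z) * monom_pow l z * (\<phi> w * cnj (monom_pow (l - k) w)))"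
      using AE_torus
    proof eventually_elim
      case (elim w)
      have "complex_of_real ((cmod (S N w))^2) = S N w * cnj (S N w)"
        by (rule complex_norm_square)
      also have "\<dots> = (\<Sum>k\<in>?B. \<Sum>l\<in>?B. cnj (monom_pow k z) * monom_pow k w * (monom_pow l z * cnj (monom_pow l w)))"
        by (simp add: S_def sum_product)
      finally have S: "complex_of_real ((cmod (S N w))^2) = \<dots>" .
      have "monom_pow (l - k) w = monom_pow l w * cnj (monom_pow k w)" for k l
        using monom_pow_add[OF elim, of l "- k"] by (simp add: monom_pow_uminus[OF elim])
      then show ?case
        unfolding S sum_distrib_left by (intro sum.cong refl) (simp add: mult_ac)
    qed
  qed (simp_all add: S_def)
  also have "\<dots> = (\<Sum>k\<in>?B. \<Sum>l\<in>?B. cnj (monom_pow k z) * monom_pow l z * fourier_coeff \<phi> (l - k))"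
    by (simp add: integrable_mult_monom_pow L2_integrable \<phi>L2 fourier_coeff_def mult.assoc)
  also have "\<dots> = (\<Sum>k\<in>?B. \<Sum>m\<in>{m \<in> ?B. k + m \<in> ?B}. fourier_coeff \<phi> m * monom_pow m z * complex_of_real ((cmod (monom_pow k z))^2))"
  proof (rule sum.cong[OF refl])
    fix k assume k: "k \<in> ?B"
    then have kn: "k \<in> nonneg_index" using index_box_subset by blast
    have "(\<Sum>l\<in>?B. cnj (monom_pow k z) * monom_pow l z * fourier_coeff \<phi> (l - k))
       = (\<Sum>l\<in>{l\<in>?B. l - k \<in> nonneg_index}. cnj (monom_pow k z) * monom_pow l z * fourier_coeff \<phi> (l - k))"
      by (rule sum.mono_neutral_right) (use fin \<phi>0 in auto)
    also have "\<dots> = (\<Sum>m\<in>{m \<in> ?B. k + m \<in> ?B}. cnj (monom_pow k z) * monom_pow (k + m) z * fourier_coeff \<phi> m)"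
    proof (rule sum.reindex_bij_witness[of _ "\<lambda>m. k + m" "\<lambda>l. l - k"])
      fix l assume l: "l \<in> {l \<in> ?B. l - k \<in> nonneg_index}"
      then have "0 \<le> l $ j - k $ j" "l $ j \<le> int N" "0 \<le> k $ j" for j
        using kn by (auto simp: nonneg_index_def index_box_def)
      then have "0 \<le> l $ j - k $ j \<and> l $ j - k $ j \<le> int N" for j
        by (metis diff_left_mono diff_zero order_trans)
      then have "l - k \<in> ?B" by (simp add: index_box_def)
      then show "l - k \<in> {m \<in> ?B. k + m \<in> ?B}" using l by simp
    qed (use index_box_subset in auto)
    also have "\<dots> = (\<Sum>m\<in>{m \<in> ?B. k + m \<in> ?B}. fourier_coeff \<phi> m * monom_pow m z * complex_of_real ((cmod (monom_pow k z))^2))"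
    proof (rule sum.cong[OF refl])
      fix m assume "m \<in> {m \<in> ?B. k + m \<in> ?B}"
      then have "m \<in> nonneg_index" using index_box_subset by blast
      then show "cnj (monom_pow k z) * monom_pow (k + m) z * fourier_coeff \<phi> m
        = fourier_coeff \<phi> m * monom_pow m z * complex_of_real ((cmod (monom_pow k z))^2)"
        unfolding complex_norm_square by (simp add: monom_pow_add_nonneg[OF kn] mult_ac)
    qed
    finally show "(\<Sum>l\<in>?B. cnj (monom_pow k z) * monom_pow l z * fourier_coeff \<phi> (l - k))
      = (\<Sum>m\<in>{m \<in> ?B. k + m \<in> ?B}. fourier_coeff \<phi> m * monom_pow m z * complex_of_real ((cmod (monom_pow k z))^2))" .
  qed
  also have "\<dots> = (\<Sum>m\<in>?B. \<Sum>k\<in>{k \<in> ?B. k + m \<in> ?B}. fourier_coeff \<phi> m * monom_pow m z * complex_of_real ((cmod (monom_pow k z))^2))"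
    by (rule sum.swap_restrict[OF fin fin])
  finally show ?thesis by (simp only: sum_distrib_left)
qed

lemma H2_const: "(\<lambda>z. c) \<in> H2"
proof -
  have "fourier_coeff (\<lambda>z. c) k = 0" if "k $ j < 0" for k :: "int^'n::finite" and j
  proof -
    have "k \<noteq> 0" using that by auto
    then have "fourier_coeff (monom_pow 0) k = 0" by (simp add: fourier_coeff_monom_pow)
    then show ?thesis by (simp add: fourier_coeff_def)
  qed
  then show ?thesis by (auto simp: H2_def L2_const)
qed

text \<open>Integrating \<open>\<phi>\<close> against the positive kernel \<open>\<bar>S\<^sub>N\<bar>\<^sup>2\<close>, where \<open>S\<^sub>N\<close> is the truncated Szego kernel
  at \<open>z\<close>, reproduces \<open>\<phi>(z)\<close> times the mass of the kernel in the limit.\<close>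

lemma analytic_ext_le_1:
  fixes \<phi> :: "complex^'n::finite \<Rightarrow> complex"
  assumes \<phi>: "\<phi> \<in> H2" and bound: "AE w in torus_measure. cmod (\<phi> w) \<le> 1" and z: "z \<in> polydisc"
  shows "cmod (analytic_ext \<phi> z) \<le> 1"
proof -
  have \<phi>L2: "\<phi> \<in> L2" using \<phi> by (simp add: H2_def)
  have [measurable]: "\<phi> \<in> borel_measurable borel" using \<phi>L2 by (rule L2_measurable)
  define b where "b m = fourier_coeff \<phi> m * monom_pow m z" for m
  define c where "c k = (cmod (monom_pow k z))^2" for k
  define T where "T N m = (\<Sum>k\<in>{k \<in> index_box N. k + m \<in> index_box N}. c k)" for N m
  define S where "S N w = (\<Sum>k\<in>index_box N. cnj (monom_pow k z) * monom_pow k w)" for N w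
  have fin: "finite (index_box N :: (int^'n) set)" for N by (rule finite_index_box)
  have T0: "T N m \<ge> 0" for N m unfolding T_def c_def by (intro sum_nonneg) auto
  have Tle: "T N m \<le> T N 0" for N m
    unfolding T_def by (rule sum_mono2) (auto simp: fin c_def)
  have id: "integral\<^sup>L torus_measure (\<lambda>w. \<psi> w * complex_of_real ((cmod (S N w))^2))
      = (\<Sum>m\<in>index_box N. fourier_coeff \<psi> m * monom_pow m z * complex_of_real (T N m))" if "\<psi> \<in> H2" for \<psi> N
    using szego_kernel_identity[OF that, where N=N and z=z] by (simp add: S_def T_def c_def)
  have S2: "S N \<in> L2" for N
    unfolding S_def[abs_def] by (intro L2_sum L2_cmult L2_monom_pow)
  \<comment> \<open>The kernel identity is applied to the constant 1, whose only nonzero coefficient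
    sits at exponent 0.\<close>
  have mass: "integral\<^sup>L torus_measure (\<lambda>w. (cmod (S N w))^2) = T N 0" for N
  proof -
    have "complex_of_real (integral\<^sup>L torus_measure (\<lambda>w. (cmod (S N w))^2))
       = integral\<^sup>L torus_measure (\<lambda>w. 1 * complex_of_real ((cmod (S N w))^2))"
      by (simp only: mult_1_left integral_complex_of_real)
    also have "\<dots> = (\<Sum>m\<in>index_box N. fourier_coeff (monom_pow 0) m * monom_pow m z * complex_of_real (T N m))"
      by (subst id[OF H2_const]) (simp add: fourier_coeff_def)
    also have "\<dots> = (\<Sum>m\<in>(index_box N :: (int^'n) set). if m = 0 then complex_of_real (T N 0) else 0)"
      by (rule sum.cong) (auto simp: fourier_coeff_monom_pow)
    also have "\<dots> = complex_of_real (T N 0)"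
      using fin[of N] by (simp add: sum.delta index_box_def)
    finally show ?thesis by (simp only: of_real_eq_iff)
  qed
  have le: "cmod (\<Sum>m\<in>index_box N. b m * complex_of_real (T N m)) \<le> T N 0" for N
  proof -
    have [measurable]: "S N \<in> borel_measurable borel" using S2 by (rule L2_measurable)
    have nn: "norm (\<phi> w * complex_of_real ((cmod (S N w))^2)) = cmod (\<phi> w) * (cmod (S N w))^2" for w
      by (simp only: norm_mult norm_of_real abs_power2)
    have ae: "AE w in torus_measure. norm (\<phi> w * complex_of_real ((cmod (S N w))^2)) \<le> (cmod (S N w))^2"
      using bound
    proof eventually_elim
      case (elim w)
      then show ?case unfolding nn using mult_right_mono[OF elim, of "(cmod (S N w))^2"] by simp
    qed
    have int: "integrable torus_measure (\<lambda>w. \<phi> w * complex_of_real ((cmod (S N w))^2))"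
      by (rule Bochner_Integration.integrable_bound[OF L2_integrable_square[OF S2[of N]]])
         (use ae in auto)
    have "cmod (integral\<^sup>L torus_measure (\<lambda>w. \<phi> w * complex_of_real ((cmod (S N w))^2)))
      \<le> integral\<^sup>L torus_measure (\<lambda>w. (cmod (S N w))^2)"
      using order_trans[OF integral_norm_bound
        integral_mono_AE[OF integrable_norm[OF int] L2_integrable_square[OF S2[of N]] ae]] .
    then show ?thesis unfolding id[OF \<phi>] mass b_def .
  qed
  have bsum: "(\<lambda>k. norm (b k)) summable_on nonneg_index"
    unfolding b_def by (rule fourier_series_abs_summable[OF \<phi>L2 z])
  have csum: "c summable_on nonneg_index"
  proof (rule summable_on_comparison_test[OF summable_monom_pow[OF z]])
    fix k :: "int^'n" assume k: "k \<in> nonneg_index"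
    have "cmod (monom_pow k z) \<le> 1"
      using k z unfolding monom_pow_def polydisc_def nonneg_index_def
      by (auto simp: power_int_def norm_power less_imp_le simp flip: prod_norm intro!: prod_le_1 power_le_one)
    then show "c k \<le> cmod (monom_pow k z)"
      unfolding c_def power2_eq_square by (intro mult_left_le) auto
  qed (simp add: c_def)
  define Ti where "Ti = infsum c nonneg_index"
  have Tlim: "(\<lambda>N. T N m) \<longlonglongrightarrow> Ti" if "m \<in> nonneg_index" for m
    using filterlim_compose[OF infsum_tendsto[OF csum] filterlim_index_box_shift[OF that]]
    by (simp add: T_def Ti_def)
  have zero: "0 \<in> nonneg_index" by (simp add: nonneg_index_def)
  \<comment> \<open>The term at exponent 0 equals 1, so the limiting mass is positive and can be
    divided out.\<close>
  have "sum c {0} \<le> Ti"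
    unfolding Ti_def by (rule finite_sum_le_infsum[OF csum]) (auto simp: zero c_def)
  then have Ti: "Ti > 0" by (simp add: c_def)
  \<comment> \<open>T N m tends to Ti for each fixed m only. The terms outside a fixed box M are
    therefore bounded by this absolute tail times T N 0, uniformly in N; N tends to infinity before
    M does.\<close>
  define \<epsilon> where "\<epsilon> M = infsum (\<lambda>k. norm (b k)) nonneg_index - (\<Sum>k\<in>index_box M. norm (b k))" for M
  have \<epsilon>: "\<epsilon> \<longlonglongrightarrow> 0"
  proof -
    have "(\<lambda>M. \<Sum>k\<in>index_box M. norm (b k)) \<longlonglongrightarrow> infsum (\<lambda>k. norm (b k)) nonneg_index"
      using filterlim_compose[OF infsum_tendsto[OF bsum] filterlim_index_box] .
    from tendsto_diff[OF tendsto_const this, of "infsum (\<lambda>k. norm (b k)) nonneg_index"] show ?thesis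
      unfolding \<epsilon>_def by simp
  qed
  have part: "cmod (\<Sum>m\<in>index_box M. b m) \<le> 1 + \<epsilon> M" for M
  proof -
    have *: "cmod (\<Sum>m\<in>index_box M. b m * complex_of_real (T N m)) \<le> T N 0 * (1 + \<epsilon> M)" if "N \<ge> M" for N
    proof -
      have sub: "index_box M \<subseteq> (index_box N :: (int^'n) set)"
        using that by (auto simp: index_box_def intro: order_trans)
      have split: "(\<Sum>m\<in>index_box M. b m * complex_of_real (T N m))
        = (\<Sum>m\<in>index_box N. b m * complex_of_real (T N m)) - (\<Sum>m\<in>index_box N - index_box M. b m * complex_of_real (T N m))"
        using sum.subset_diff[OF sub fin, of "\<lambda>m. b m * complex_of_real (T N m)"] by simp
      have "cmod (\<Sum>m\<in>index_box N - index_box M. b m * complex_of_real (T N m))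
        \<le> (\<Sum>m\<in>index_box N - index_box M. norm (b m) * T N 0)"
        by (rule sum_norm_le) (auto simp: norm_mult T0 intro!: mult_left_mono Tle)
      also have "\<dots> = (\<Sum>m\<in>index_box N - index_box M. norm (b m)) * T N 0"
        by (simp add: sum_distrib_right)
      also have "\<dots> \<le> \<epsilon> M * T N 0"
      proof (rule mult_right_mono[OF _ T0])
        have "(\<Sum>m\<in>index_box N. norm (b m)) \<le> infsum (\<lambda>k. norm (b k)) nonneg_index"
          by (rule finite_sum_le_infsum[OF bsum]) (use fin index_box_subset in auto)
        then show "(\<Sum>m\<in>index_box N - index_box M. norm (b m)) \<le> \<epsilon> M"
          using sum.subset_diff[OF sub fin, of "\<lambda>m. norm (b m)"] by (simp add: \<epsilon>_def)
      qed
      finally have "cmod (\<Sum>m\<in>index_box M. b m * complex_of_real (T N m)) \<le> T N 0 + \<epsilon> M * T N 0"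
        unfolding split using le[of N] by (intro order_trans[OF norm_triangle_ineq4] add_mono)
      then show ?thesis by (simp add: algebra_simps)
    qed
    have "(\<lambda>N. cmod (\<Sum>m\<in>index_box M. b m * complex_of_real (T N m))) \<longlonglongrightarrow> cmod (\<Sum>m\<in>index_box M. b m * complex_of_real Ti)"
      by (intro tendsto_intros Tlim) (use index_box_subset in auto)
    moreover have "(\<lambda>N. T N 0 * (1 + \<epsilon> M)) \<longlonglongrightarrow> Ti * (1 + \<epsilon> M)"
      by (intro tendsto_intros Tlim zero)
    ultimately have "cmod (\<Sum>m\<in>index_box M. b m * complex_of_real Ti) \<le> Ti * (1 + \<epsilon> M)"
      by (rule LIMSEQ_le) (use * in blast)
    moreover have "(\<Sum>m\<in>index_box M. b m * complex_of_real Ti) = (\<Sum>m\<in>index_box M. b m) * complex_of_real Ti"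
      by (simp add: sum_distrib_right)
    ultimately show ?thesis using Ti by (simp add: norm_mult mult.commute)
  qed
  have "(\<lambda>M. cmod (\<Sum>m\<in>index_box M. b m)) \<longlonglongrightarrow> cmod (analytic_ext \<phi> z)"
    unfolding b_def by (intro tendsto_norm analytic_ext_LIMSEQ \<phi>L2 z)
  moreover have "(\<lambda>M. 1 + \<epsilon> M) \<longlonglongrightarrow> 1 + 0" by (intro tendsto_intros \<epsilon>)
  ultimately show ?thesis
    using LIMSEQ_le[of "\<lambda>M. cmod (\<Sum>m\<in>index_box M. b m)" _ "\<lambda>M. 1 + \<epsilon> M" 1] part by auto
qed

subsection \<open>Duality\<close>

text \<open>The function g is w \<mapsto> \<phi>(r w). For w on the torus the point r w stays in the
  polydisc, where the Schur bound holds and the power series converges absolutely, so the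
  coefficients of g can be read off term by term.\<close>

lemma schur_class_dilation:
  fixes \<phi> :: "complex^'n::finite \<Rightarrow> complex"
  assumes \<phi>: "\<phi> \<in> schur_class" and r: "0 < r" "r < 1"
  obtains g where "g \<in> L2" "AE w in torus_measure. cmod (g w) \<le> 1"
    "\<And>k. fourier_coeff g k = fourier_coeff \<phi> k * monom_pow k (\<chi> j. complex_of_real r)"
proof -
  define \<rho> where "\<rho> = (\<chi> j. complex_of_real r :: complex^'n)"
  have \<phi>L2: "\<phi> \<in> L2" and \<phi>0: "\<And>k. k \<notin> nonneg_index \<Longrightarrow> fourier_coeff \<phi> k = 0"
    and \<phi>1: "\<And>z. z \<in> polydisc \<Longrightarrow> cmod (analytic_ext \<phi> z) \<le> 1"
    using \<phi> by (auto simp: schur_class_def H2_def nonneg_index_def not_le)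
  define a where "a k = fourier_coeff \<phi> k * monom_pow k \<rho>" for k
  define s where "s N w = (\<Sum>k\<in>index_box N. a k * monom_pow k w)" for N w
  \<comment> \<open>Defining g as a pointwise limit of polynomials makes it Borel measurable; on the
    torus it agrees with the analytic extension at r w.\<close>
  define g where "g w = lim (\<lambda>N. s N w)" for w
  have fin: "finite (index_box N :: (int^'n) set)" for N by (rule finite_index_box)
  have \<rho>: "\<rho> \<in> polydisc" using r by (simp add: \<rho>_def polydisc_def)
  have \<rho>w: "\<rho> * w \<in> polydisc" if "w \<in> torus" for w
    using that r by (simp add: \<rho>_def polydisc_def torus_def norm_mult)
  have lim: "(\<lambda>N. s N w) \<longlonglongrightarrow> analytic_ext \<phi> (\<rho> * w)" if "w \<in> torus" for w
    using analytic_ext_LIMSEQ[OF \<phi>L2 \<rho>w[OF that]]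
    by (simp add: s_def a_def monom_pow_times mult.assoc)
  have g_eq: "g w = analytic_ext \<phi> (\<rho> * w)" if "w \<in> torus" for w
    unfolding g_def using lim[OF that] by (rule limI)
  have [measurable]: "s N \<in> borel_measurable borel" for N
    unfolding s_def[abs_def] by measurable
  have [measurable]: "g \<in> borel_measurable borel"
    unfolding g_def[abs_def] by measurable
  have g1: "AE w in torus_measure. cmod (g w) \<le> 1"
    using AE_torus by eventually_elim (simp add: g_eq \<phi>1 \<rho>w)
  have asum: "(\<lambda>k. norm (a k)) summable_on nonneg_index"
    unfolding a_def by (rule fourier_series_abs_summable[OF \<phi>L2 \<rho>])
  define B where "B = infsum (\<lambda>k. norm (a k)) nonneg_index"
  have sB: "cmod (s N w) \<le> B" if "w \<in> torus" for N w
  proof -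
    have "cmod (s N w) \<le> (\<Sum>k\<in>index_box N. norm (a k))"
      unfolding s_def by (rule sum_norm_le) (simp add: norm_mult norm_monom_pow_torus[OF that])
    also have "\<dots> \<le> B"
      unfolding B_def by (rule finite_sum_le_infsum[OF asum]) (use fin index_box_subset in auto)
    finally show ?thesis .
  qed
  have "fourier_coeff g k = a k" for k
  proof -
    have g_lim: "(\<lambda>N. fourier_coeff (s N) k) \<longlonglongrightarrow> fourier_coeff g k"
      unfolding fourier_coeff_def
    proof (rule integral_dominated_convergence[where w="\<lambda>_. B"])
      show "AE w in torus_measure. (\<lambda>N. s N w * cnj (monom_pow k w)) \<longlonglongrightarrow> g w * cnj (monom_pow k w)"
        using AE_torus
      proof eventually_elim
        case (elim w)
        show ?case by (intro tendsto_mult tendsto_const) (simp add: g_eq lim elim)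
      qed
      show "AE w in torus_measure. norm (s N w * cnj (monom_pow k w)) \<le> B" for N
        using AE_torus by eventually_elim (simp add: norm_mult norm_monom_pow_torus sB)
    qed simp_all
    have s_coeff: "fourier_coeff (s N) k = (if k \<in> index_box N then a k else 0)" for N
    proof -
      have "fourier_coeff (s N) k = (\<Sum>l\<in>index_box N. a l * fourier_coeff (monom_pow l) k)"
        unfolding fourier_coeff_def s_def
        by (simp add: sum_distrib_right mult.assoc integrable_mult_monom_pow L2_integrable L2_monom_pow)
      also have "\<dots> = (\<Sum>l\<in>index_box N. if l = k then a k else 0)"
        by (rule sum.cong) (auto simp: fourier_coeff_monom_pow)
      finally show ?thesis using fin by simp
    qed
    have "(\<lambda>N. if k \<in> index_box N then a k else 0) \<longlonglongrightarrow> a k"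
    proof (cases "k \<in> nonneg_index")
      case True
      then have "\<forall>\<^sub>F N in sequentially. {k} \<subseteq> index_box N"
        using filterlim_index_box[unfolded filterlim_finite_subsets_at_top, rule_format, of "{k}"]
        by (auto elim: eventually_mono)
      then have "\<forall>\<^sub>F N in sequentially. (if k \<in> index_box N then a k else 0) = a k"
        by eventually_elim simp
      then show ?thesis by (rule tendsto_eventually)
    next
      case False
      then have "a k = 0" by (simp add: a_def \<phi>0)
      then have "(\<lambda>N. if k \<in> index_box N then a k else 0) = (\<lambda>_. a k)" by auto
      then show ?thesis by simp
    qed
    then show ?thesis by (rule LIMSEQ_unique[OF g_lim[unfolded s_coeff]])
  qed
  then have "fourier_coeff g k = fourier_coeff \<phi> k * monom_pow k (\<chi> j. complex_of_real r)" for k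
    by (simp add: a_def \<rho>_def)
  moreover have "g \<in> L2" by (rule L2_bounded[OF _ g1]) measurable
  ultimately show ?thesis using that g1 by blast
qed

section \<open>Pairing the Schur class with L^2 functions\<close>

lemma norm_l2_inner_le_norm1:
  assumes "u \<in> L2" "g \<in> L2" "AE w in torus_measure. cmod (g w) \<le> 1"
  shows "cmod (l2_inner u g) \<le> norm1 u"
proof -
  have "cmod (l2_inner u g) \<le> integral\<^sup>L torus_measure (\<lambda>z. cmod (u z * cnj (g z)))"
    unfolding l2_inner_def by (rule integral_norm_bound)
  also have "\<dots> \<le> norm1 u"
    unfolding norm1_def
  proof (rule integral_mono_AE)
    show "AE z in torus_measure. cmod (u z * cnj (g z)) \<le> cmod (u z)"
      using assms(3) by eventually_elim (simp add: norm_mult mult_left_le)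
  qed (use L2_integrable_inner[OF assms(1,2)] L2_integrable[OF assms(1)] in auto)
  finally show ?thesis .
qed

lemma norm1_triangle:
  assumes "u \<in> L2" "v \<in> L2" shows "norm1 u \<le> norm1 v + norm1 (\<lambda>z. u z - v z)"
proof -
  have int: "integrable torus_measure (\<lambda>z. cmod (u z))" "integrable torus_measure (\<lambda>z. cmod (v z))"
    "integrable torus_measure (\<lambda>z. cmod (u z - v z))"
    using assms L2_diff[OF assms] by (auto intro!: integrable_norm L2_integrable)
  have "norm1 u \<le> integral\<^sup>L torus_measure (\<lambda>z. cmod (v z) + cmod (u z - v z))"
    unfolding norm1_def using int
    by (intro integral_mono) (auto intro: norm_triangle_sub)
  then show ?thesis using int by (simp add: norm1_def)
qed

text \<open>This integrated estimate stands in for the boundary bound |\<phi>| \<le> 1 almost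
  everywhere. Each dilation satisfies it. Coefficients of dilations converge to those of \<phi>,
  which gives it for trigonometric polynomials u; density extends it to L^2, as both sides are
  continuous in the L^2 norm.\<close>

lemma schur_class_inner_le_norm1:
  fixes \<phi> :: "complex^'n::finite \<Rightarrow> complex"
  assumes \<phi>: "\<phi> \<in> schur_class" and u: "u \<in> L2"
  shows "cmod (l2_inner u \<phi>) \<le> norm1 u"
proof -
  have \<phi>L2: "\<phi> \<in> L2" using \<phi> by (auto simp: schur_class_def H2_def)
  \<comment> \<open>The denominator n + 2 keeps the radius strictly positive at n = 0, as the
    dilation statement requires.\<close>
  define r where "r n = 1 - 1 / real (Suc (Suc n))" for n
  have r01: "0 < r n" "r n < 1" for n by (auto simp: r_def)
  have "r \<longlonglongrightarrow> 1 - 0"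
    unfolding r_def by (intro tendsto_intros LIMSEQ_Suc lim_1_over_n)
  then have r: "r \<longlonglongrightarrow> 1" by simp
  have "\<exists>g. g \<in> L2 \<and> (AE w in torus_measure. cmod (g w) \<le> 1) \<and>
    (\<forall>k. fourier_coeff g k = fourier_coeff \<phi> k * monom_pow k (\<chi> j. complex_of_real (r n)))" for n
    by (rule schur_class_dilation[OF \<phi> r01[of n]]) blast
  then obtain G where G: "\<And>n. G n \<in> L2" "\<And>n. AE w in torus_measure. cmod (G n w) \<le> 1"
    "\<And>n k. fourier_coeff (G n) k = fourier_coeff \<phi> k * monom_pow k (\<chi> j. complex_of_real (r n))"
    by metis
  have coeff: "(\<lambda>n. fourier_coeff (G n) k) \<longlonglongrightarrow> fourier_coeff \<phi> k" for k
  proof -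
    have "(\<lambda>n. monom_pow k (\<chi> j. complex_of_real (r n) :: complex^'n)) \<longlonglongrightarrow> (\<Prod>j\<in>UNIV. complex_of_real 1 powi (k $ j))"
      unfolding monom_pow_def by (simp only: vec_lambda_beta) (intro tendsto_intros r, simp)
    from tendsto_mult[OF tendsto_const this, of "fourier_coeff \<phi> k"] show ?thesis
      unfolding G by simp
  qed
  have trig: "cmod (l2_inner p \<phi>) \<le> norm1 p" if "p \<in> trig_span UNIV" for p
  proof -
    have "(\<lambda>n. l2_inner p (G n)) \<longlonglongrightarrow> l2_inner p \<phi>"
      using that
    proof (induction rule: trig_span.induct)
      case zero show ?case by (simp add: l2_inner_def)
    next
      case (step k p c)
      have eq: "l2_inner (\<lambda>z. c * monom_pow k z + p z) v = c * cnj (fourier_coeff v k) + l2_inner p v" if "v \<in> L2" for v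
        unfolding fourier_coeff_eq_inner using that step(2)
        by (simp add: l2_inner_add_left L2_cmult L2_monom_pow trig_span_L2 l2_inner_cmult_left
            flip: l2_inner_commute)
      show ?case
        unfolding eq[OF G(1)] eq[OF \<phi>L2] by (intro tendsto_intros coeff step)
    qed
    then have "(\<lambda>n. cmod (l2_inner p (G n))) \<longlonglongrightarrow> cmod (l2_inner p \<phi>)"
      by (rule tendsto_norm)
    then show ?thesis
      by (rule LIMSEQ_le_const2)
         (use norm_l2_inner_le_norm1[OF trig_span_L2[OF that] G(1) G(2)] in blast)
  qed
  obtain Y where Y: "\<And>j. Y j \<in> trig_span UNIV" "l2_conv Y u"
    using L2_trig_approximation[OF u, of UNIV] by auto
  have YL2: "Y j \<in> L2" for j by (rule trig_span_L2[OF Y(1)])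
  have "(\<lambda>j. cmod (l2_inner (Y j) \<phi>)) \<longlonglongrightarrow> cmod (l2_inner u \<phi>)"
    by (intro tendsto_norm l2_conv_inner Y YL2 u \<phi>L2)
  moreover have "(\<lambda>j. norm1 u + norm2 (\<lambda>z. Y j z - u z)) \<longlonglongrightarrow> norm1 u + 0"
    using Y(2) unfolding l2_conv_def by (intro tendsto_intros)
  moreover have "cmod (l2_inner (Y j) \<phi>) \<le> norm1 u + norm2 (\<lambda>z. Y j z - u z)" for j
    using trig[OF Y(1), of j] norm1_triangle[OF YL2 u, of j] norm1_le_norm2[OF L2_diff[OF YL2 u], of j]
    by linarith
  ultimately show ?thesis
    using LIMSEQ_le[of "\<lambda>j. cmod (l2_inner (Y j) \<phi>)" _ "\<lambda>j. norm1 u + norm2 (\<lambda>z. Y j z - u z)"] by force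
qed

section \<open>The spaces H^2 and L_n in terms of Fourier coefficients\<close>

lemma fourier_coeff_cnj: "fourier_coeff (\<lambda>z. cnj (u z)) k = cnj (fourier_coeff u (- k))"
  if [measurable]: "u \<in> borel_measurable borel"
proof -
  have "fourier_coeff (\<lambda>z. cnj (u z)) k = integral\<^sup>L torus_measure (\<lambda>z. cnj (u z * cnj (monom_pow (- k) z)))"
    unfolding fourier_coeff_def
  proof (rule integral_cong_AE)
    show "AE z in torus_measure. cnj (u z) * cnj (monom_pow k z) = cnj (u z * cnj (monom_pow (- k) z))"
      using AE_torus by eventually_elim (simp add: monom_pow_uminus)
  qed (simp_all, measurable)
  then show ?thesis unfolding fourier_coeff_def by (simp only: Bochner_Integration.integral_cnj)
qed

lemma fourier_coeff_add:
  "u \<in> L2 \<Longrightarrow> v \<in> L2 \<Longrightarrow> fourier_coeff (\<lambda>z. u z + v z) k = fourier_coeff u k + fourier_coeff v k"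
  by (simp add: fourier_coeff_eq_inner l2_inner_add_left L2_monom_pow)

lemma fourier_coeff_diff:
  "u \<in> L2 \<Longrightarrow> v \<in> L2 \<Longrightarrow> fourier_coeff (\<lambda>z. u z - v z) k = fourier_coeff u k - fourier_coeff v k"
  by (simp add: fourier_coeff_eq_inner l2_inner_diff_left L2_monom_pow)

lemma fourier_coeff_cmult: "fourier_coeff (\<lambda>z. c * u z) k = c * fourier_coeff u k"
  by (simp add: fourier_coeff_eq_inner l2_inner_cmult_left)

lemma fourier_coeff_l2_conv:
  assumes "l2_conv X x" "\<And>j. X j \<in> L2" "x \<in> L2" "\<And>j. fourier_coeff (X j) k = 0"
  shows "fourier_coeff x k = 0"
  using l2_conv_inner[OF assms(1-3) L2_monom_pow, of k] assms(4)
  by (simp add: fourier_coeff_eq_inner LIMSEQ_const_iff)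

lemma H2_L2: "u \<in> H2 \<Longrightarrow> u \<in> L2"
  by (simp add: H2_def)

lemma H2_add: "u \<in> H2 \<Longrightarrow> v \<in> H2 \<Longrightarrow> (\<lambda>z. u z + v z) \<in> H2"
  by (auto simp: H2_def fourier_coeff_add L2_add)

lemma H2_cmult: "u \<in> H2 \<Longrightarrow> (\<lambda>z. c * u z) \<in> H2"
  by (auto simp: H2_def fourier_coeff_cmult L2_cmult)

lemma H2_diff: "u \<in> H2 \<Longrightarrow> v \<in> H2 \<Longrightarrow> (\<lambda>z. u z - v z) \<in> H2"
  by (auto simp: H2_def fourier_coeff_diff L2_diff)

lemma H2_l2_conv:
  assumes "l2_conv X x" "\<And>j. X j \<in> H2" "x \<in> L2" shows "x \<in> H2"
proof -
  have "fourier_coeff x k = 0" if "k $ j < 0" for k j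
    using assms that by (intro fourier_coeff_l2_conv[OF assms(1)]) (auto simp: H2_def)
  with assms(3) show ?thesis by (auto simp: H2_def)
qed

lemma monom_pow_H2: "k \<in> nonneg_index \<Longrightarrow> monom_pow k \<in> H2"
  by (auto simp: H2_def L2_monom_pow fourier_coeff_monom_pow nonneg_index_def not_less)

text \<open>An exponent with some positive entry is either of mixed sign or nonnegative and nonzero;
  these are the exponents of M_n and of H^2_0. What remains is k \<le> 0, so \<open>L_space\<close>
  consists of the conjugates of L^2 functions orthogonal to H^2, the form used by both
  implications.\<close>

lemma L_space_eq: "L_space = {u \<in> L2. \<forall>k. (\<forall>j. k $ j \<le> 0) \<longrightarrow> fourier_coeff u k = 0}"
proof (intro set_eqI iffI)
  fix u :: "complex^'n::finite \<Rightarrow> complex" assume "u \<in> L_space"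
  then obtain m h where u: "u = (\<lambda>z. m z + h z)" and m: "m \<in> M_space" and h: "h \<in> H2_0"
    by (auto simp: L_space_def)
  have L2: "m \<in> L2" "h \<in> L2" using m h by (auto simp: M_space_def H2_0_def H2_def)
  have "fourier_coeff u k = 0" if k: "\<forall>j. k $ j \<le> 0" for k
  proof -
    have "fourier_coeff m k = 0" using m k by (auto simp: M_space_def not_less)
    moreover have "fourier_coeff h k = 0"
    proof (cases "k = 0")
      case True then show ?thesis using h by (simp add: H2_0_def analytic_ext_0)
    next
      case False
      then obtain j where "k $ j \<noteq> 0" by (auto simp: vec_eq_iff)
      then have "k $ j < 0" using k by (simp add: less_le)
      then show ?thesis using h by (auto simp: H2_0_def H2_def)
    qed
    ultimately show ?thesis by (simp add: u fourier_coeff_add L2)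
  qed
  then show "u \<in> {u \<in> L2. \<forall>k. (\<forall>j. k $ j \<le> 0) \<longrightarrow> fourier_coeff u k = 0}"
    using L2 by (simp add: u L2_add)
next
  fix u :: "complex^'n::finite \<Rightarrow> complex"
  assume u: "u \<in> {u \<in> L2. \<forall>k. (\<forall>j. k $ j \<le> 0) \<longrightarrow> fourier_coeff u k = 0}"
  then have uL2: "u \<in> L2" by simp
  have H: "(H2_0 :: (complex^'n \<Rightarrow> complex) set) = {h \<in> H2. fourier_coeff h 0 = 0}"
    by (simp add: H2_0_def analytic_ext_0)
  \<comment> \<open>Here h is the projection of u on H^2_0. It lies in H^2_0 itself because
    vanishing of a coefficient survives L^2 limits, and u - h is orthogonal to every nonconstant
    monomial with nonnegative exponents.\<close>
  obtain Y h where Y: "\<And>j. Y j \<in> H2_0" "h \<in> L2" "l2_conv Y h"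
    "\<And>t. t \<in> H2_0 \<Longrightarrow> l2_inner t (\<lambda>z. u z - h z) = 0"
  proof (rule l2_projection[of "H2_0 :: (complex^'n \<Rightarrow> complex) set" u])
    have "(\<lambda>z. 0) \<in> (H2_0 :: (complex^'n \<Rightarrow> complex) set)"
      using H2_const[of 0] by (simp add: H fourier_coeff_def)
    then show "(H2_0 :: (complex^'n \<Rightarrow> complex) set) \<noteq> {}" by blast
  qed (auto simp: H H2_L2 H2_add H2_cmult fourier_coeff_add fourier_coeff_cmult uL2)
  have YH: "Y j \<in> H2" "fourier_coeff (Y j) 0 = 0" for j using Y(1)[of j] by (auto simp: H)
  have hH: "h \<in> H2_0"
    using H2_l2_conv[OF Y(3) YH(1) Y(2)] fourier_coeff_l2_conv[OF Y(3) H2_L2[OF YH(1)] Y(2) YH(2)]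
    by (simp add: H)
  define m where "m z = u z - h z" for z
  have mL2: "m \<in> L2" unfolding m_def[abs_def] by (intro L2_diff uL2 Y)
  have "fourier_coeff m k = 0" if k: "\<not> ((\<exists>i. 0 < k $ i) \<and> (\<exists>j. k $ j < 0))" for k
  proof (cases "\<forall>j. k $ j \<le> 0")
    case True
    have "fourier_coeff h k = 0"
    proof (cases "k = 0")
      case True then show ?thesis using hH by (simp add: H)
    next
      case False
      then obtain j where "k $ j \<noteq> 0" by (auto simp: vec_eq_iff)
      then have "k $ j < 0" using True by (simp add: less_le)
      then show ?thesis using hH by (auto simp: H2_0_def H2_def)
    qed
    then show ?thesis
      using u True unfolding m_def[abs_def] by (simp add: fourier_coeff_diff Y)
  next
    case False
    then obtain i where i: "0 < k $ i" by (auto simp: not_le)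
    with k have "\<forall>j. \<not> k $ j < 0" by blast
    then have "k \<in> nonneg_index" by (simp add: nonneg_index_def not_less)
    moreover have "k \<noteq> 0" using i by auto
    ultimately have "monom_pow k \<in> H2_0"
      by (simp add: H monom_pow_H2 fourier_coeff_monom_pow)
    from Y(4)[OF this] show ?thesis
      by (subst fourier_coeff_eq_inner, subst l2_inner_commute) (simp add: m_def[abs_def])
  qed
  then have "m \<in> M_space" using mL2 by (auto simp: M_space_def)
  moreover have "u = (\<lambda>z. m z + h z)" by (auto simp: m_def)
  ultimately show "u \<in> L_space" using hH unfolding L_space_def by blast
qed

lemma H2_inner_zero:
  assumes \<phi>: "\<phi> \<in> H2" and w: "w \<in> L2" "\<And>k. k \<in> nonneg_index \<Longrightarrow> fourier_coeff w k = 0"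
  shows "l2_inner \<phi> w = 0"
proof -
  have \<phi>L2: "\<phi> \<in> L2" using \<phi> by (rule H2_L2)
  obtain Y where Y: "\<And>j. Y j \<in> trig_span nonneg_index" "l2_conv Y \<phi>"
    using L2_trig_approximation[OF \<phi>L2, of nonneg_index] \<phi>
    by (auto simp: H2_def nonneg_index_def not_le)
  have "l2_inner p w = 0" if "p \<in> trig_span nonneg_index" for p
    using that
  proof (induction rule: trig_span.induct)
    case zero show ?case by (simp add: l2_inner_def)
  next
    case (step k p c)
    have "l2_inner (monom_pow k) w = 0"
      using w(2)[OF step(1)] by (subst l2_inner_commute) (simp flip: fourier_coeff_eq_inner)
    with step show ?case
      by (simp add: l2_inner_add_left L2_cmult L2_monom_pow trig_span_L2 w l2_inner_cmult_left)
  qed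
  then show ?thesis
    using l2_conv_inner[OF Y(2) trig_span_L2[OF Y(1)] \<phi>L2 w(1)] Y(1) by (simp add: LIMSEQ_const_iff)
qed

lemma norm1_cnj: "norm1 (\<lambda>z. cnj (u z)) = norm1 u"
  by (simp add: norm1_def)

lemma norm1_cmult: "norm1 (\<lambda>z. c * u z) = cmod c * norm1 u"
  by (simp add: norm1_def norm_mult)

section \<open>The two implications\<close>

lemma schur_extension_imp_dist:
  fixes f :: "complex^'n::finite \<Rightarrow> complex"
  assumes f: "f \<in> H2" "norm2 f > 0" and g: "g \<in> H2" "l2_inner g f = 0"
    and s: "(\<lambda>z. f z + g z) \<in> schur_class"
  shows "dist_L1 (\<lambda>z. cnj (f z) / of_real ((norm2 f)^2)) L_space \<ge> 1"
  unfolding dist_L1_def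
proof (rule cINF_greatest)
  have "(\<lambda>z. 0) \<in> (L_space :: (complex^'n \<Rightarrow> complex) set)"
    by (simp add: L_space_eq L2_const fourier_coeff_def)
  then show "(L_space :: (complex^'n \<Rightarrow> complex) set) \<noteq> {}" by blast
next
  fix h :: "complex^'n \<Rightarrow> complex" assume h: "h \<in> L_space"
  then have hL2: "h \<in> L2" and h0: "\<And>k. (\<forall>j. k $ j \<le> 0) \<Longrightarrow> fourier_coeff h k = 0"
    by (auto simp: L_space_eq)
  define \<phi> where "\<phi> z = f z + g z" for z
  define c where "c = complex_of_real ((norm2 f)^2)"
  have c: "c \<noteq> 0" "cnj c = c" using f(2) by (auto simp: c_def)
  have L2: "f \<in> L2" "g \<in> L2" "\<phi> \<in> L2" "\<phi> \<in> H2"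
    using f g unfolding \<phi>_def[abs_def] by (auto intro: H2_L2 H2_add L2_add)
  \<comment> \<open>This is the conjugate of the difference whose L^1 norm is to be bounded, so that
    it pairs with \<phi> under \<open>l2_inner\<close>. The part along f contributes 1, since <f, f
    + g> is the squared norm of f; the part from h contributes 0.\<close>
  define v where "v z = inverse c * f z - cnj (h z)" for z
  have vL2: "v \<in> L2" unfolding v_def[abs_def] by (intro L2_diff L2_cmult L2_cnj hL2 L2)
  have "l2_inner \<phi> (\<lambda>z. cnj (h z)) = 0"
    by (rule H2_inner_zero)
       (use L2 hL2 h0 in \<open>auto simp: L2_cnj fourier_coeff_cnj L2_measurable nonneg_index_def\<close>)
  then have "l2_inner (\<lambda>z. cnj (h z)) \<phi> = 0"
    by (subst l2_inner_commute) simp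
  moreover have "l2_inner f \<phi> = c"
  proof -
    have "l2_inner \<phi> f = c"
      unfolding \<phi>_def[abs_def] c_def using g L2 by (simp add: l2_inner_add_left l2_inner_self)
    then show ?thesis using c by (subst l2_inner_commute) simp
  qed
  ultimately have "l2_inner v \<phi> = 1"
    unfolding v_def[abs_def] using c
    by (simp add: l2_inner_diff_left L2_cmult L2_cnj hL2 L2 l2_inner_cmult_left)
  then have "1 \<le> norm1 v"
    using schur_class_inner_le_norm1[OF s vL2] by (simp add: \<phi>_def[abs_def])
  also have "norm1 v = norm1 (\<lambda>z. cnj (v z))" by (simp add: norm1_cnj)
  also have "(\<lambda>z. cnj (v z)) = (\<lambda>z. cnj (f z) / c - h z)"
    by (simp add: v_def c divide_inverse mult.commute)
  finally show "1 \<le> norm1 (\<lambda>z. cnj (f z) / of_real ((norm2 f)^2) - h z)"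
    by (simp add: c_def)
qed

text \<open>A separation argument in L^2: if f were not in the closure of K + B, the minimal vector
  x would be a nonzero separating functional, and its normalised conjugate would contradict the
  distance hypothesis.\<close>

lemma dist_imp_ball_dense:
  fixes f :: "complex^'n::finite \<Rightarrow> complex"
  assumes f: "f \<in> H2" "norm2 f > 0"
    and dist: "dist_L1 (\<lambda>z. cnj (f z) / of_real ((norm2 f)^2)) L_space \<ge> 1"
    and e: "e > 0"
  obtains \<phi> b where "\<phi> \<in> borel_measurable borel" "AE z in torus_measure. cmod (\<phi> z) \<le> 1"
    "b \<in> H2" "l2_inner b f = 0" "norm2 (\<lambda>z. \<phi> z + b z - f z) < e"
proof -
  define c where "c = (norm2 f)^2"
  have c: "c > 0" using f(2) by (simp add: c_def)
  have fL2: "f \<in> L2" using f(1) by (rule H2_L2)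
  have ff: "l2_inner f f = complex_of_real c" by (simp add: l2_inner_self c_def)
  define K where "K = {\<phi> :: complex^'n \<Rightarrow> complex. \<phi> \<in> borel_measurable borel \<and> (AE z in torus_measure. cmod (\<phi> z) \<le> 1)}"
  define B where "B = {b \<in> H2. l2_inner b f = 0}"
  have KL2: "\<phi> \<in> L2" if "\<phi> \<in> K" for \<phi> using that by (auto simp: K_def intro: L2_bounded)
  have BL2: "b \<in> L2" if "b \<in> B" for b using that by (auto simp: B_def H2_L2)
  have Badd: "(\<lambda>z. b z + b' z) \<in> B" if "b \<in> B" "b' \<in> B" for b b'
    using that by (auto simp: B_def H2_add l2_inner_add_left H2_L2 fL2)
  have Bcm: "(\<lambda>z. a * b z) \<in> B" if "b \<in> B" for b a
    using that by (auto simp: B_def H2_cmult l2_inner_cmult_left)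
  have Kconv: "(\<lambda>z. complex_of_real (1 - t) * \<phi> z + complex_of_real t * \<psi> z) \<in> K"
    if "\<phi> \<in> K" "\<psi> \<in> K" "0 \<le> t" "t \<le> 1" for \<phi> \<psi> t
  proof -
    have "AE z in torus_measure. cmod (complex_of_real (1 - t) * \<phi> z + complex_of_real t * \<psi> z) \<le> 1"
    proof -
      have "AE z in torus_measure. cmod (\<phi> z) \<le> 1" "AE z in torus_measure. cmod (\<psi> z) \<le> 1"
        using that by (auto simp: K_def)
      then show ?thesis
      proof eventually_elim
        case (elim z)
        have "cmod (complex_of_real (1 - t) * \<phi> z + complex_of_real t * \<psi> z)
          \<le> (1 - t) * cmod (\<phi> z) + t * cmod (\<psi> z)"
          using that norm_triangle_ineq[of "complex_of_real (1 - t) * \<phi> z" "complex_of_real t * \<psi> z"]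
          by (simp add: norm_mult del: of_real_diff)
        also have "\<dots> \<le> (1 - t) * 1 + t * 1"
          using that elim by (intro add_mono mult_left_mono) auto
        finally show ?case by simp
      qed
    qed
    moreover have "(\<lambda>z. complex_of_real (1 - t) * \<phi> z + complex_of_real t * \<psi> z) \<in> borel_measurable borel"
      using that by (intro borel_measurable_add borel_measurable_times borel_measurable_const) (auto simp: K_def)
    ultimately show ?thesis by (simp add: K_def)
  qed
  define C where "C = {(\<lambda>z. \<phi> z + b z - f z) | \<phi> b. \<phi> \<in> K \<and> b \<in> B}"
  have CI: "(\<lambda>z. \<phi> z + b z - f z) \<in> C" if "\<phi> \<in> K" "b \<in> B" for \<phi> b
    using that unfolding C_def by blast
  have zK: "(\<lambda>z. 0) \<in> K" by (simp add: K_def)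
  have zB: "(\<lambda>z. 0) \<in> B" using H2_const[of 0] by (simp add: B_def l2_inner_def)
  have "C \<subseteq> L2"
    using L2_diff[OF L2_add[OF KL2 BL2] fL2] by (auto simp: C_def)
  moreover have "C \<noteq> {}" using CI[OF zK zB] by blast
  moreover have "(\<lambda>z. complex_of_real (1 - t) * u z + complex_of_real t * v z) \<in> C"
    if uv: "u \<in> C" "v \<in> C" and t: "0 \<le> t" "t \<le> 1" for u v t
  proof -
    obtain \<phi> b where 1: "u = (\<lambda>z. \<phi> z + b z - f z)" "\<phi> \<in> K" "b \<in> B" using uv(1) unfolding C_def by blast
    obtain \<psi> d where 2: "v = (\<lambda>z. \<psi> z + d z - f z)" "\<psi> \<in> K" "d \<in> B" using uv(2) unfolding C_def by blast
    have eq: "(\<lambda>z. complex_of_real (1 - t) * u z + complex_of_real t * v z)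
      = (\<lambda>z. (complex_of_real (1 - t) * \<phi> z + complex_of_real t * \<psi> z)
        + (complex_of_real (1 - t) * b z + complex_of_real t * d z) - f z)"
      by (auto simp: 1 2 fun_eq_iff algebra_simps)
    show ?thesis
      unfolding eq by (rule CI[OF Kconv[OF 1(2) 2(2) t] Badd[OF Bcm[OF 1(3)] Bcm[OF 2(3)]]])
  qed
  ultimately obtain X x where X: "\<And>j. X j \<in> C" "x \<in> L2" "l2_conv X x"
    "\<And>y. y \<in> C \<Longrightarrow> (norm2 x)^2 \<le> Re (l2_inner y x)"
    by (rule convex_minimal_norm) (auto simp del: of_real_diff)
  have XL2: "X j \<in> L2" for j using X(1) \<open>C \<subseteq> L2\<close> by blast
  have x0: "norm2 x = 0"
  proof (rule ccontr)
    assume "norm2 x \<noteq> 0"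
    then have xpos: "(norm2 x)^2 > 0" by simp
    have [measurable]: "x \<in> borel_measurable borel" using X(2) by (rule L2_measurable)
    \<comment> \<open>Taking 0 from the ball K leaves all of the linear space B available, so the
      variational inequality is a bound below over every multiple of b.\<close>
    have Bx: "l2_inner b x = 0" if b: "b \<in> B" for b
    proof (rule eq_0_if_Re_mult_bounded_below[of "(norm2 x)^2 + Re (l2_inner f x)"])
      fix a
      have "(\<lambda>z. 0 + a * b z - f z) \<in> C" by (rule CI[OF zK Bcm[OF b]])
      from X(4)[OF this] show "(norm2 x)^2 + Re (l2_inner f x) \<le> Re (a * l2_inner b x)"
        by (simp add: l2_inner_diff_left L2_cmult BL2 b fL2 X l2_inner_cmult_left)
    qed
    \<comment> \<open>Among functions in the unit ball this one makes Re <\<sigma>,x> smallest,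
      namely \<open>- norm1 x\<close>. At zeros of x, division by zero gives the harmless value
      0.\<close>
    define \<sigma> where "\<sigma> z = - (x z / complex_of_real (cmod (x z)))" for z
    have \<sigma>K: "\<sigma> \<in> K"
      unfolding K_def \<sigma>_def by (auto simp: norm_divide)
    have "\<sigma> z * cnj (x z) = complex_of_real (- cmod (x z))" for z
      by (cases "x z = 0") (simp_all add: \<sigma>_def complex_norm_square[symmetric] power2_eq_square)
    then have "l2_inner \<sigma> x = integral\<^sup>L torus_measure (\<lambda>z. complex_of_real (- cmod (x z)))"
      by (simp only: l2_inner_def)
    then have \<sigma>x: "l2_inner \<sigma> x = complex_of_real (- norm1 x)"
      unfolding integral_complex_of_real by (simp add: norm1_def)
    have "(\<lambda>z. \<sigma> z + 0 - f z) \<in> C" by (rule CI[OF \<sigma>K zB])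
    from X(4)[OF this] have "(norm2 x)^2 \<le> - norm1 x - Re (l2_inner f x)"
      by (simp add: l2_inner_diff_left KL2 \<sigma>K fL2 X \<sigma>x)
    with xpos have lt: "norm1 x < - Re (l2_inner f x)" by linarith
    \<comment> \<open>The projection of x on f is cnj a times f. Subtracting it yields w, orthogonal
      to f as well as to B, hence to H^2.\<close>
    define a where "a = l2_inner f x / complex_of_real c"
    have fx: "l2_inner f x = a * complex_of_real c" using c by (simp add: a_def)
    define w where "w z = x z - cnj a * f z" for z
    have wL2: "w \<in> L2" unfolding w_def[abs_def] by (intro L2_diff L2_cmult fL2 X)
    have inner_w: "l2_inner u w = l2_inner u x - a * l2_inner u f" if "u \<in> L2" for u
    proof -
      have "l2_inner w u = l2_inner x u - cnj a * l2_inner f u"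
        unfolding w_def[abs_def] using that by (simp add: l2_inner_diff_left L2_cmult fL2 X l2_inner_cmult_left)
      then show ?thesis
        by (subst l2_inner_commute, subst (2) l2_inner_commute, subst (3) l2_inner_commute) simp
    qed
    have wH: "l2_inner u w = 0" if u: "u \<in> H2" for u
    proof -
      have uL2: "u \<in> L2" using u by (rule H2_L2)
      define \<beta> where "\<beta> = l2_inner u f / complex_of_real c"
      have \<beta>: "\<beta> * complex_of_real c = l2_inner u f" using c by (simp add: \<beta>_def)
      have "(\<lambda>z. u z - \<beta> * f z) \<in> B"
        using u f(1) by (auto simp: B_def H2_diff H2_cmult l2_inner_diff_left L2_cmult uL2 fL2 l2_inner_cmult_left ff \<beta>)
      from Bx[OF this] have "l2_inner u x = \<beta> * l2_inner f x"
        by (simp add: l2_inner_diff_left L2_cmult uL2 fL2 X l2_inner_cmult_left)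
      then show ?thesis using c by (simp add: inner_w uL2 fx \<beta>_def)
    qed
    have "0 \<le> norm1 x" by (simp add: norm1_def)
    with lt have "Re a * c < 0" by (simp add: fx)
    then have a0: "a \<noteq> 0" using c by auto
    \<comment> \<open>From conj x = a conj f + conj w, this choice makes conj f / c - h equal to
      conj x / (a c), whose L^1 norm is \<open>norm1 x\<close> / |<f,x>|.\<close>
    define h where "h z = (- 1 / (a * complex_of_real c)) * cnj (w z)" for z
    have hL: "h \<in> L_space"
    proof -
      have "fourier_coeff h k = 0" if k: "\<forall>j. k $ j \<le> 0" for k
      proof -
        have "- k \<in> nonneg_index" using k by (simp add: nonneg_index_def)
        from wH[OF monom_pow_H2[OF this]] have "fourier_coeff w (- k) = 0"
          unfolding fourier_coeff_eq_inner by (subst l2_inner_commute) simp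
        then show ?thesis
          unfolding h_def[abs_def] fourier_coeff_cmult using fourier_coeff_cnj[OF L2_measurable[OF wL2]] by simp
      qed
      moreover have "h \<in> L2" unfolding h_def[abs_def] by (intro L2_cmult L2_cnj wL2)
      ultimately show ?thesis by (simp add: L_space_eq)
    qed
    have "1 \<le> norm1 (\<lambda>z. cnj (f z) / of_real ((norm2 f)^2) - h z)"
    proof (rule order_trans[OF dist])
      show "dist_L1 (\<lambda>z. cnj (f z) / of_real ((norm2 f)^2)) L_space
        \<le> norm1 (\<lambda>z. cnj (f z) / of_real ((norm2 f)^2) - h z)"
        unfolding dist_L1_def
        by (rule cINF_lower[OF _ hL]) (auto intro!: bdd_belowI[of _ 0] simp: norm1_def)
    qed
    also have "(\<lambda>z. cnj (f z) / of_real ((norm2 f)^2) - h z) = (\<lambda>z. (1 / (a * complex_of_real c)) * cnj (x z))"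
      using a0 c by (auto simp: h_def w_def c_def[symmetric] fun_eq_iff field_simps simp del: of_real_power)
    finally have "1 \<le> norm1 x / (cmod a * c)"
      unfolding norm1_cmult norm1_cnj using c by (simp add: norm_divide norm_mult)
    then have "cmod a * c \<le> norm1 x" using a0 c by (simp add: field_simps)
    also note lt
    also have "- Re (l2_inner f x) \<le> cmod a * c"
      using mult_right_mono[of "- Re a" "cmod a" c] c abs_Re_le_cmod[of a] by (simp add: fx)
    finally show False by simp
  qed
  have "(\<lambda>j. norm2 (X j)) \<longlonglongrightarrow> 0"
    using l2_conv_norm2[OF X(3) XL2 X(2)] by (simp add: x0)
  from order_tendstoD(2)[OF this e] obtain j where "norm2 (X j) < e"
    by (auto simp: eventually_sequentially)
  moreover obtain \<phi> b where "X j = (\<lambda>z. \<phi> z + b z - f z)" "\<phi> \<in> K" "b \<in> B"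
    using X(1)[of j] unfolding C_def by blast
  ultimately show ?thesis using that[of \<phi> b] by (simp add: K_def B_def)
qed

text \<open>Density alone does not solve f = \<phi> + b, since the pair depends on the tolerance.
  Boundedness of the ball in L^2 allows the approximate \<phi> to be chosen convergent in norm; the
  corresponding b then converge too, and the linear conditions defining B are closed.\<close>

lemma dist_imp_schur_extension:
  fixes f :: "complex^'n::finite \<Rightarrow> complex"
  assumes f: "f \<in> H2" "norm2 f > 0"
    and dist: "dist_L1 (\<lambda>z. cnj (f z) / of_real ((norm2 f)^2)) L_space \<ge> 1"
  obtains g where "g \<in> H2" "l2_inner g f = 0" "(\<lambda>z. f z + g z) \<in> schur_class"
proof -
  have fL2: "f \<in> L2" using f(1) by (rule H2_L2)
  \<comment> \<open>The denominator \<open>Suc j\<close> matters at j = 0: a tolerance 1/0 would be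
    0 and demand an exact solution, destroying the nesting.\<close>
  define C where "C j = {\<phi>. \<phi> \<in> borel_measurable borel \<and> (AE z in torus_measure. cmod (\<phi> z) \<le> 1) \<and>
    (\<exists>b\<in>H2. l2_inner b f = 0 \<and> norm2 (\<lambda>z. \<phi> z + b z - f z) \<le> 1 / real (Suc j))}" for j
  have CL2: "C j \<subseteq> L2" for j by (auto simp: C_def intro: L2_bounded)
  obtain X \<phi> where X: "\<And>j. X j \<in> C j" "\<phi> \<in> L2" "l2_conv X \<phi>"
  proof (rule nested_convex_l2_conv[of C 1, OF CL2])
    fix i j :: nat assume "i \<le> j"
    then have "1 / real (Suc j) \<le> 1 / real (Suc i)" by (simp add: frac_le)
    then show "C j \<subseteq> C i" by (force simp: C_def intro: order_trans)
  next
    fix j u v assume u: "u \<in> C j" and v: "v \<in> C j"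
    obtain b where b: "b \<in> H2" "l2_inner b f = 0" "norm2 (\<lambda>z. u z + b z - f z) \<le> 1 / real (Suc j)"
      using u by (auto simp: C_def)
    obtain d where d: "d \<in> H2" "l2_inner d f = 0" "norm2 (\<lambda>z. v z + d z - f z) \<le> 1 / real (Suc j)"
      using v by (auto simp: C_def)
    have L2: "u \<in> L2" "v \<in> L2" "b \<in> L2" "d \<in> L2" using u v b d CL2 H2_L2 by auto
    let ?b = "\<lambda>z. (1/2) * (b z + d z)"
    have eq: "(\<lambda>z. (u z + v z) / 2 + ?b z - f z)
      = (\<lambda>z. (1/2) * ((u z + b z - f z) + (v z + d z - f z)))"
      by (auto simp: fun_eq_iff field_simps)
    have "norm2 (\<lambda>z. (u z + v z) / 2 + ?b z - f z) \<le> 1 / real (Suc j)"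
      unfolding eq norm2_cmult
      using norm2_triangle[of "\<lambda>z. u z + b z - f z" "\<lambda>z. v z + d z - f z"] b(3) d(3) L2 fL2
      by (simp add: L2_add L2_diff)
    moreover have "?b \<in> H2" "l2_inner ?b f = 0"
      using b d L2 fL2 by (auto intro!: H2_cmult H2_add simp: l2_inner_cmult_left l2_inner_add_left simp del: times_divide_eq_left)
    moreover have "AE z in torus_measure. cmod ((u z + v z) / 2) \<le> 1"
    proof -
      have "AE z in torus_measure. cmod (u z) \<le> 1" "AE z in torus_measure. cmod (v z) \<le> 1"
        using u v by (auto simp: C_def)
      then show ?thesis
      proof eventually_elim
        case (elim z)
        then show ?case using norm_triangle_ineq[of "u z" "v z"] by (simp add: norm_divide)
      qed
    qed
    ultimately show "(\<lambda>z. (u z + v z) / 2) \<in> C j"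
      using L2[THEN L2_measurable] unfolding C_def by auto
  next
    fix j
    obtain \<psi> b where \<psi>: "\<psi> \<in> borel_measurable borel" "AE z in torus_measure. cmod (\<psi> z) \<le> 1"
      "b \<in> H2" "l2_inner b f = 0" "norm2 (\<lambda>z. \<psi> z + b z - f z) < 1 / real (Suc j)"
      using dist_imp_ball_dense[OF f dist, of "1 / real (Suc j)"] by auto
    have \<psi>L2: "\<psi> \<in> L2" using \<psi> by (auto intro: L2_bounded)
    \<comment> \<open>Since the torus has mass 1, the sup bound gives L^2 norm at most 1, the
      uniform bound required for the nested sets.\<close>
    have "(norm2 \<psi>)^2 \<le> integral\<^sup>L torus_measure (\<lambda>z::complex^'n. 1::real)"
      unfolding norm2_square
    proof (rule integral_mono_AE[OF L2_integrable_square[OF \<psi>L2]])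
      show "AE z in torus_measure. (cmod (\<psi> z))^2 \<le> 1"
        using \<psi>(2) by eventually_elim (simp add: power_le_one)
    qed simp
    then have "(norm2 \<psi>)^2 \<le> 1^2" by simp
    then have "norm2 \<psi> \<le> 1" by (rule power2_le_imp_le) simp
    moreover have "\<psi> \<in> C j" using \<psi> unfolding C_def by (auto simp: less_imp_le)
    ultimately show "\<exists>u\<in>C j. norm2 u \<le> 1" by blast
  qed blast
  have XL2: "X j \<in> L2" for j using X(1) CL2 by blast
  have \<phi>1: "AE z in torus_measure. cmod (\<phi> z) \<le> 1"
    by (rule l2_conv_norm_le_1[OF X(3) XL2 X(2)]) (use X(1) in \<open>auto simp: C_def\<close>)
  have "\<forall>j. \<exists>b\<in>H2. l2_inner b f = 0 \<and> norm2 (\<lambda>z. X j z + b z - f z) \<le> 1 / real (Suc j)"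
    using X(1) by (auto simp: C_def)
  then obtain b where b: "\<And>j. b j \<in> H2" "\<And>j. l2_inner (b j) f = 0"
    "\<And>j. norm2 (\<lambda>z. X j z + b j z - f z) \<le> 1 / real (Suc j)"
    by metis
  have bL2: "b j \<in> L2" for j using b(1) by (rule H2_L2)
  define g where "g z = \<phi> z - f z" for z
  have gL2: "g \<in> L2" unfolding g_def[abs_def] by (intro L2_diff X fL2)
  \<comment> \<open>The sign changes because X j + b j is close to f, whereas g = \<phi> - f is to
    be the limit.\<close>
  define b' where "b' j z = (-1) * b j z" for j z
  have b'H: "b' j \<in> H2" and b'f: "l2_inner (b' j) f = 0" for j
    unfolding b'_def[abs_def] l2_inner_cmult_left using H2_cmult[OF b(1), of "-1"] b(2) by auto
  have b'L2: "b' j \<in> L2" for j using b'H by (rule H2_L2)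
  have conv: "l2_conv b' g"
    unfolding l2_conv_def
  proof (rule tendsto_sandwich[OF _ _ tendsto_const])
    have "norm2 (\<lambda>z. b' j z - g z) \<le> 1 / real (Suc j) + norm2 (\<lambda>z. X j z - \<phi> z)" for j
    proof -
      have "(\<lambda>z. b' j z - g z) = (\<lambda>z. (-1) * (X j z + b j z - f z) + (X j z - \<phi> z))"
        by (auto simp: b'_def g_def fun_eq_iff)
      then have "norm2 (\<lambda>z. b' j z - g z)
        \<le> norm2 (\<lambda>z. (-1) * (X j z + b j z - f z)) + norm2 (\<lambda>z. X j z - \<phi> z)"
        using norm2_triangle[of "\<lambda>z. (-1) * (X j z + b j z - f z)" "\<lambda>z. X j z - \<phi> z"]
        by (simp only: L2_cmult L2_add L2_diff XL2 bL2 fL2 X(2))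
      then show ?thesis using b(3)[of j] unfolding norm2_cmult by simp
    qed
    then show "\<forall>\<^sub>F j in sequentially. norm2 (\<lambda>z. b' j z - g z) \<le> 1 / real (Suc j) + norm2 (\<lambda>z. X j z - \<phi> z)"
      by simp
    have "(\<lambda>j. 1 / real (Suc j) + norm2 (\<lambda>z. X j z - \<phi> z)) \<longlonglongrightarrow> 0 + 0"
      using X(3) unfolding l2_conv_def by (intro tendsto_add LIMSEQ_Suc lim_1_over_n)
    then show "(\<lambda>j. 1 / real (Suc j) + norm2 (\<lambda>z. X j z - \<phi> z)) \<longlonglongrightarrow> 0" by simp
  qed simp
  have gH: "g \<in> H2" by (rule H2_l2_conv[OF conv b'H gL2])
  have gf: "l2_inner g f = 0"
    using l2_conv_inner[OF conv b'L2 gL2 fL2] by (simp add: b'f LIMSEQ_const_iff)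
  have fg: "(\<lambda>z. f z + g z) = \<phi>" by (auto simp: g_def)
  have \<phi>H: "\<phi> \<in> H2" using H2_add[OF f(1) gH] by (simp add: fg)
  have "\<phi> \<in> schur_class"
    using \<phi>H analytic_ext_le_1[OF \<phi>H \<phi>1] by (simp add: schur_class_def)
  then show ?thesis using that[OF gH gf] by (simp add: fg)
qed

theorem theorem5p1:
  fixes f :: "complex^'n::finite \<Rightarrow> complex"
  assumes "f \<in> H2"
    and "\<not> (AE z in torus_measure. f z = 0)"
  shows "(\<exists>g\<in>H2. l2_inner g f = 0 \<and> (\<lambda>z. f z + g z) \<in> schur_class)
     \<longleftrightarrow> dist_L1 (\<lambda>z. cnj (f z) / of_real ((norm2 f)^2)) L_space \<ge> 1"
proof -
  have "norm2 f \<noteq> 0"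
    using assms norm2_eq_0_iff[OF H2_L2[OF assms(1)]] by blast
  then have "norm2 f > 0" by (simp add: less_le)
  then show ?thesis
    using schur_extension_imp_dist[OF assms(1)] dist_imp_schur_extension[OF assms(1)] by metis
qed

end
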